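(* Assume that $\mathbb{P}(\lim_{|t|\to\infty}|\boldsymbol Y_t|=0)=1$ and that $$\mathbb{E}\left[\left(\sum_{j\in\mathbb{Z}}|\boldsymbol Q_j|\right)^\alpha\right]<\infty\quad\text{or}\quad\mathbb{E}\left[\left(\sum_{j=0}^\infty|\boldsymbol\Theta_j|\right)^{\alpha-1}\right]<\infty .$$ Let $H$ be a non negative, shift invariant, $1$-homogeneous measurable function on $(\mathbb{R}^d)^{\mathbb{Z}}$ such that $$|H(\boldsymbol x)-H(\boldsymbol y)|\le C|\boldsymbol x-\boldsymbol y|_1$$ for some constant $C>0$ and all $\boldsymbol x,\boldsymbol y\in(\mathbb{R}^d)^{\mathbb{Z}}$. Then $\mathbb{E}[|H^\alpha(\boldsymbol\Theta_{0,\infty})-H^\alpha(\boldsymbol\Theta_{1,\infty})|]<\infty$ and $$\vartheta\,\mathbb{E}[H^\alpha(\boldsymbol Q)]=\mathbb{E}\left[H^\alpha(\boldsymbol\Theta_{0,\infty})-H^\alpha(\boldsymbol\Theta_{1,\infty})\right].$$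
   Context: Let $|\cdot|$ be an arbitrary norm on $\mathbb{R}^d$. Let $\{\boldsymbol X_j,j\in\mathbb{Z}\}$ be a stationary $\mathbb{R}^d$-valued time series which is regularly varying: for all integers $s\le t$ there is a non-zero Radon measure $\nu_{s,t}$ on $(\mathbb{R}^d)^{[s,t]}\setminus\{\boldsymbol 0\}$ such that $\mathbb{P}(u^{-1}(\boldsymbol X_s,\dots,\boldsymbol X_t)\in\cdot)/\mathbb{P}(|\boldsymbol X_0|>u)\to\nu_{s,t}$ vaguely as $u\to\infty$. Let $\alpha>0$ be its tail index. The tail process is the random sequence $\boldsymbol Y=\{\boldsymbol Y_j,j\in\mathbb{Z}\}$ with $\mathbb{P}(|\boldsymbol Y_0|>y)=y^{-\alpha}$ for $y\ge1$ and such that, for all $s\le t$, the law of $u^{-1}(\boldsymbol X_s,\dots,\boldsymbol X_t)$ conditionally on $|\boldsymbol X_0|>u$ converges weakly to that of $(\boldsymbol Y_s,\dots,\boldsymbol Y_t)$ as $u\to\infty$. The spectral tail process is $\boldsymbol\Theta_j=\boldsymbol Y_j/|\boldsymbol Y_0|$, $j\in\mathbb{Z}$; it is independent of $|\boldsymbol Y_0|$. The tail measure $\nu$ is the unique Borel measure on $(\mathbb{R}^d)^{\mathbb{Z}}$ (product topology) with $\nu(\{\boldsymbol 0\})=0$ and $\nu\circ p_{s,t}^{-1}=\nu_{s,t}$ on $(\mathbb{R}^d)^{[s,t]}\setminus\{\boldsymbol 0\}$ for all $s\le t$, where $p_{s,t}$ is the canonical projection. It is known that $\nu$ is $\sigma$-finite,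 shift invariant, satisfies $\nu(c\,\cdot)=c^{-\alpha}\nu$ for all $c>0$, and $\mathbb{E}[H(\boldsymbol Y)]=\int H(\boldsymbol y)\mathbf{1}\{|\boldsymbol y_0|>1\}\,\nu(\mathrm{d}\boldsymbol y)$ for every non negative measurable $H$. Notation: $|\boldsymbol x|_1=\sum_{j\in\mathbb{Z}}|\boldsymbol x_j|\in[0,\infty]$; $H^\alpha(\boldsymbol x)=(H(\boldsymbol x))^\alpha$. $\boldsymbol x_{n,\infty}$ is identified with the element of $(\mathbb{R}^d)^{\mathbb{Z}}$ obtained from $\boldsymbol x$ by setting the coordinates of index $<n$ to zero. $B$ is the backshift, $(B\boldsymbol x)_j=\boldsymbol x_{j-1}$; $H$ is shift invariant if $H(B\boldsymbol x)=H(\boldsymbol x)$ for all $\boldsymbol x$, and $1$-homogeneous if $H(t\boldsymbol x)=tH(\boldsymbol x)$ for all $\boldsymbol x$ and $t>0$. For $-\infty\le s\le t\le\infty$, $\boldsymbol y^*_{s,t}=\max_{s\le i\le t}|\boldsymbol y_i|$ and $\boldsymbol y^*=\max_{i\in\mathbb{Z}}|\boldsymbol y_i|$ (understood as suprema in $[0,\infty]$). The candidate extremal index is $\vartheta=\mathbb{P}(\sup_{j\ge1}|\boldsymbol Y_j|\le1)$, which also equals $\mathbb{P}(\sup_{j\le-1}|\boldsymbol Y_j|\le1)$; when $\mathbb{P}(\lim_{|k|\to\infty}|\boldsymbol Y_k|=0)=1$, one has $\vartheta>0$. In that case $\boldsymbol Q=\{\boldsymbol Q_j,j\in\mathbb{Z}\}$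 denotes a random sequence whose distribution is that of $(\boldsymbol Y^* )^{-1}\boldsymbol Y$ conditionally on $\boldsymbol Y^*_{-\infty,-1}\le1$. *)

theory Defs
  imports "HOL-Probability.Probability"
begin

definition is_norm :: "(real ^ 'n \<Rightarrow> real) \<Rightarrow> bool" where
  "is_norm N \<longleftrightarrow>
     (\<forall>x. N x = 0 \<longleftrightarrow> x = 0) \<and>
     (\<forall>c x. N (c *\<^sub>R x) = \<bar>c\<bar> * N x) \<and>
     (\<forall>x y. N (x + y) \<le> N x + N y)"


text \<open>Power with real exponent on $[0,\infty]$, with $x^0 = 1$ for all $x$,
  $0^a = \infty$ and $\infty^a = 0$ for $a < 0$.\<close>

definition enn_powr :: "ennreal \<Rightarrow> real \<Rightarrow> ennreal" where
  "enn_powr x a =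
     (if a = 0 then 1
      else if x = \<infinity> then (if a > 0 then \<infinity> else 0)
      else if x = 0 \<and> a < 0 then \<infinity>
      else ennreal (enn2real x powr a))"


text \<open>The index ranges over the integers, so $(\mathbb{R}^d)^{[s,t]}$ is represented by the
  functions on the integers that are \<^const>\<open>undefined\<close> outside \<open>{s..t}\<close>, with the topology
  \<open>window_topology\<close>. The sequence space $(\mathbb{R}^d)^{\mathbb{Z}}$ is the whole type
  \<^typ>\<open>int \<Rightarrow> real ^ 'n\<close>, with the product topology of its type class instance.\<close>

definition window_topology :: "int \<Rightarrow> int \<Rightarrow> (int \<Rightarrow> real ^ 'n) topology" where
  "window_topology s t = product_topology (\<lambda>_. euclidean) {s..t}"

definition window :: "int \<Rightarrow> int \<Rightarrow> (int \<Rightarrow> real ^ 'n) \<Rightarrow> (int \<Rightarrow> real ^ 'n)" where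
  "window s t x = restrict x {s..t}"

definition window_zero :: "int \<Rightarrow> int \<Rightarrow> (int \<Rightarrow> real ^ 'n)" where
  "window_zero s t = window s t (\<lambda>_. 0)"

definition window_scale :: "int \<Rightarrow> int \<Rightarrow> real \<Rightarrow> (int \<Rightarrow> real ^ 'n) \<Rightarrow> (int \<Rightarrow> real ^ 'n)" where
  "window_scale s t c x = window s t (\<lambda>j. c *\<^sub>R x j)"

definition punctured_window :: "int \<Rightarrow> int \<Rightarrow> (int \<Rightarrow> real ^ 'n) measure" where
  "punctured_window s t =
     restrict_space (Pi\<^sub>M {s..t} (\<lambda>_. borel)) (- {window_zero s t})"

text \<open>A set is compact in the punctured space iff it is compact in the whole space and
  does not contain the origin, and a continuous function with compact support on the
  punctured space is the same as a continuous function on the whole space that vanishes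
  off such a set.\<close>

definition punctured_compact :: "int \<Rightarrow> int \<Rightarrow> (int \<Rightarrow> real ^ 'n) set \<Rightarrow> bool" where
  "punctured_compact s t K \<longleftrightarrow> compactin (window_topology s t) K \<and> window_zero s t \<notin> K"

definition punctured_test_function ::
    "int \<Rightarrow> int \<Rightarrow> ((int \<Rightarrow> real ^ 'n) \<Rightarrow> real) \<Rightarrow> bool" where
  "punctured_test_function s t f \<longleftrightarrow>
     continuous_map (window_topology s t) euclideanreal f \<and>
     (\<exists>K. punctured_compact s t K \<and> (\<forall>x \<in> topspace (window_topology s t) - K. f x = 0))"

definition nonzero_radon :: "int \<Rightarrow> int \<Rightarrow> (int \<Rightarrow> real ^ 'n) measure \<Rightarrow> bool" where
  "nonzero_radon s t \<mu> \<longleftrightarrow>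
     sets \<mu> = sets (punctured_window s t) \<and>
     emeasure \<mu> (space \<mu>) \<noteq> 0 \<and>
     (\<forall>K. punctured_compact s t K \<longrightarrow> emeasure \<mu> K < \<infinity>)"


definition stationary_series :: "'w measure \<Rightarrow> (int \<Rightarrow> 'w \<Rightarrow> real ^ 'n) \<Rightarrow> bool" where
  "stationary_series M X \<longleftrightarrow>
     (\<forall>j. X j \<in> borel_measurable M) \<and>
     (\<forall>h. distr M borel (\<lambda>\<omega> j. X (j + h) \<omega>) = distr M borel (\<lambda>\<omega> j. X j \<omega>))"

text \<open>Since the limit is non-zero and division by zero yields zero, the convergence
  below forces the probability that the norm of \<open>X 0\<close> exceeds \<open>u\<close> to be positive for
  every \<open>u\<close>.\<close>

definition regularly_varying ::
    "(real ^ 'n \<Rightarrow> real) \<Rightarrow> 'w measure \<Rightarrow> (int \<Rightarrow> 'w \<Rightarrow> real ^ 'n) \<Rightarrow>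
     (int \<Rightarrow> int \<Rightarrow> (int \<Rightarrow> real ^ 'n) measure) \<Rightarrow> bool" where
  "regularly_varying N M X \<nu> \<longleftrightarrow>
     (\<forall>s t. s \<le> t \<longrightarrow>
        nonzero_radon s t (\<nu> s t) \<and>
        (\<forall>f. punctured_test_function s t f \<longrightarrow>
           ((\<lambda>u. (\<integral>\<omega>. f (window s t (\<lambda>j. (1 / u) *\<^sub>R X j \<omega>)) \<partial>M) /
                  measure M {\<omega> \<in> space M. u < N (X 0 \<omega>)})
             \<longlongrightarrow> (\<integral>x. f x \<partial>(\<nu> s t))) at_top))"

definition tail_index :: "(int \<Rightarrow> int \<Rightarrow> (int \<Rightarrow> real ^ 'n) measure) \<Rightarrow> real \<Rightarrow> bool" where
  "tail_index \<nu> \<alpha> \<longleftrightarrow>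
     (\<forall>s t c A. s \<le> t \<longrightarrow> c > 0 \<longrightarrow> A \<in> sets (\<nu> s t) \<longrightarrow>
        emeasure (\<nu> s t) (window_scale s t c ` A) =
          ennreal (c powr (- \<alpha>)) * emeasure (\<nu> s t) A)"


text \<open>The measure \<^term>\<open>uniform_measure M A\<close> is the conditional probability given \<open>A\<close>.
  Weak convergence of laws is tested on bounded continuous functions.\<close>

definition tail_process ::
    "(real ^ 'n \<Rightarrow> real) \<Rightarrow> real \<Rightarrow> 'w measure \<Rightarrow> (int \<Rightarrow> 'w \<Rightarrow> real ^ 'n) \<Rightarrow>
     'v measure \<Rightarrow> (int \<Rightarrow> 'v \<Rightarrow> real ^ 'n) \<Rightarrow> bool" where
  "tail_process N \<alpha> M X P Y \<longleftrightarrow>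
     (\<forall>j. Y j \<in> borel_measurable P) \<and>
     (\<forall>y\<ge>1. measure P {\<omega> \<in> space P. y < N (Y 0 \<omega>)} = y powr (- \<alpha>)) \<and>
     (\<forall>s t f. s \<le> t \<longrightarrow>
        continuous_map (window_topology s t) euclideanreal f \<longrightarrow>
        bounded (f ` topspace (window_topology s t)) \<longrightarrow>
        ((\<lambda>u. \<integral>\<omega>. f (window s t (\<lambda>j. (1 / u) *\<^sub>R X j \<omega>))
                \<partial>(uniform_measure M {\<omega> \<in> space M. u < N (X 0 \<omega>)}))
          \<longlongrightarrow> (\<integral>\<omega>. f (window s t (\<lambda>j. Y j \<omega>)) \<partial>P)) at_top)"

definition spectral_tail ::
    "(real ^ 'n \<Rightarrow> real) \<Rightarrow> (int \<Rightarrow> 'v \<Rightarrow> real ^ 'n) \<Rightarrow> int \<Rightarrow> 'v \<Rightarrow> real ^ 'n" where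
  "spectral_tail N Y j \<omega> = (1 / N (Y 0 \<omega>)) *\<^sub>R Y j \<omega>"

definition sup_norm :: "(real ^ 'n \<Rightarrow> real) \<Rightarrow> int set \<Rightarrow> (int \<Rightarrow> real ^ 'n) \<Rightarrow> ennreal" where
  "sup_norm N J x = (SUP j\<in>J. ennreal (N (x j)))"

definition sum_norm :: "(real ^ 'n \<Rightarrow> real) \<Rightarrow> int set \<Rightarrow> (int \<Rightarrow> real ^ 'n) \<Rightarrow> ennreal" where
  "sum_norm N J x = (\<Sum>\<^sub>\<infinity>j\<in>J. ennreal (N (x j)))"

definition candidate_extremal_index ::
    "(real ^ 'n \<Rightarrow> real) \<Rightarrow> 'v measure \<Rightarrow> (int \<Rightarrow> 'v \<Rightarrow> real ^ 'n) \<Rightarrow> real" where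
  "candidate_extremal_index N P Y =
     measure P {\<omega> \<in> space P. sup_norm N {1..} (\<lambda>j. Y j \<omega>) \<le> 1}"

text \<open>If the supremum is infinite, \<^const>\<open>enn2real\<close> maps it to zero, whose inverse is
  zero; this agrees with the convention $1/\infty = 0$.\<close>

definition cluster_process ::
    "(real ^ 'n \<Rightarrow> real) \<Rightarrow> 'v measure \<Rightarrow> (int \<Rightarrow> 'v \<Rightarrow> real ^ 'n) \<Rightarrow>
     'q measure \<Rightarrow> (int \<Rightarrow> 'q \<Rightarrow> real ^ 'n) \<Rightarrow> bool" where
  "cluster_process N P Y R Q \<longleftrightarrow>
     (\<forall>j. Q j \<in> borel_measurable R) \<and>
     distr R borel (\<lambda>\<omega> j. Q j \<omega>) =
       distr (uniform_measure P {\<omega> \<in> space P. sup_norm N {..-1} (\<lambda>j. Y j \<omega>) \<le> 1}) borel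
         (\<lambda>\<omega> j. inverse (enn2real (sup_norm N UNIV (\<lambda>i. Y i \<omega>))) *\<^sub>R Y j \<omega>)"

definition zero_before :: "int \<Rightarrow> (int \<Rightarrow> real ^ 'n) \<Rightarrow> (int \<Rightarrow> real ^ 'n)" where
  "zero_before n x = (\<lambda>j. if j < n then 0 else x j)"

definition shift_invariant :: "((int \<Rightarrow> real ^ 'n) \<Rightarrow> real) \<Rightarrow> bool" where
  "shift_invariant H \<longleftrightarrow> (\<forall>x. H (\<lambda>j. x (j - 1)) = H x)"

definition one_homogeneous :: "((int \<Rightarrow> real ^ 'n) \<Rightarrow> real) \<Rightarrow> bool" where
  "one_homogeneous H \<longleftrightarrow> (\<forall>t>0. \<forall>x. H (\<lambda>j. t *\<^sub>R x j) = t * H x)"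

end

theory Submission
  imports Defs
begin

text \<open>Write $\Theta$ for the angle $Y/|Y_0|$, $B$ for the backshift and $K = H^\alpha$. Everything rests on
the identity \<open>cluster_formula\<close>: for every measurable $G \ge 0$ with
$G(cy) = c^\alpha G(y)$ for $c > 0$,
\[ \vartheta\, E\Big[\sum_j 1\{Q_j \ne 0\}\, G(B^{-j} Q)\Big] = E[G(\Theta)]. \]
It says that $\Theta$ is the cluster $Q$ looked at from a coordinate $j$ that is drawn with weight
$|Q_j|^\alpha$. Take for $G$ the positive and the negative part of
$y \mapsto K(y_{0,\infty}) - K(y_{1,\infty})$. As $H$ is shift invariant, the summand at $j$ becomes
the corresponding part of $K(Q_{j,\infty}) - K(Q_{j+1,\infty})$, and these differences telescope to
$K(Q)$: if $\sum_j |Q_j| < \infty$, the Lipschitz condition gives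
$K(Q_{n,\infty}) \to K(Q)$ as $n \to -\infty$ and $K(Q_{n,\infty}) \to 0$ as $n \to \infty$.

The cluster formula comes from the time change formula
\[ E[F(Y)\, 1\{|Y_i| > t\}] = t^{-\alpha} E[F(t B^i Y)\, 1\{t |Y_{-i}| > 1\}], \qquad 0 < t \le 1, \]
which is the stationarity of $X$ carried over to the limit (\<open>law_time_change\<close>). For
each $j$ it is applied with $i = j$ to a functional that lives on the event that $Y$ exceeds $1$ for
the first time at $0$. On the right-hand side this event turns into the event that $tY$ exceeds $1$
for the first time at $-j$; over all $j$ these events partition $\{t Y^* > 1\}$, because $Y$ tends to
zero. The independence of $|Y_0|$ and $\Theta$, itself the case $i = 0$ of the time change formula,
gives the remaining integral, and $t \downarrow 0$ yields the claim. The conditioning event for $Q$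
looks into the past and $\vartheta$ into the future; both have the same probability by a time change
that exchanges the first and the last exceedance.

Integrability comes from $E[(\sum_j |Q_j|)^\alpha] < \infty$. This moment bounds $E[K(Q)]$ and, for
$\alpha > 1$, through the cluster formula also the mean of
$|K(\Theta_{0,\infty}) - K(\Theta_{1,\infty})|$; for $\alpha \le 1$ the latter is at most $C^\alpha$
pointwise. If $\alpha \le 1$, the moment is always finite, because
$(\sum_j |Q_j|)^\alpha \le \sum_j |Q_j|^\alpha$ and the latter sum has mean $1/\vartheta$ by the
cluster formula. If $\alpha > 1$ and the moment condition is the one on $\Theta$, use the telescoping
bound $(\sum_j |Q_j|)^\alpha \le \alpha \sum_j |Q_j| (\sum_{k \ge j} |Q_k|)^{\alpha - 1}$: by the
cluster formula its right-hand side has mean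
$\alpha\vartheta^{-1} E[(\sum_{k \ge 0} |\Theta_k|)^{\alpha-1}]$.\<close>

section \<open>Arbitrary norms on a Euclidean space\<close>

lemma is_norm_nonneg: "is_norm N \<Longrightarrow> N x \<ge> 0"
proof -
  assume N: "is_norm N"
  have "N (x + (-1) *\<^sub>R x) \<le> N x + N ((-1) *\<^sub>R x)" using N unfolding is_norm_def by blast
  moreover have "N ((-1) *\<^sub>R x) = N x" using N unfolding is_norm_def by (metis abs_minus_cancel abs_one mult_1)
  moreover have "N (x + (-1) *\<^sub>R x) = 0" using N unfolding is_norm_def by simp
  ultimately show ?thesis by simp
qed

lemma is_norm_scale: "is_norm N \<Longrightarrow> N (c *\<^sub>R x) = \<bar>c\<bar> * N x"
  unfolding is_norm_def by blast

lemma is_norm_zero: "is_norm N \<Longrightarrow> N x = 0 \<longleftrightarrow> x = 0"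
  unfolding is_norm_def by blast

lemma is_norm_sum:
  assumes "is_norm N" "finite A"
  shows "N (sum f A) \<le> (\<Sum>a\<in>A. N (f a))"
  using assms(2)
proof (induction A rule: finite_induct)
  case empty
  then show ?case using is_norm_zero[OF assms(1), of 0] by simp
next
  case (insert a A)
  have "N (f a + sum f A) \<le> N (f a) + N (sum f A)" using assms(1) unfolding is_norm_def by blast
  with insert show ?case by simp
qed

text \<open>A norm is Lipschitz with respect to the Euclidean norm: expand in the standard basis.\<close>

lemma is_norm_continuous:
  fixes N :: "real ^ 'n \<Rightarrow> real"
  assumes N: "is_norm N"
  shows "continuous_on UNIV N"
proof (rule lipschitz_on_continuous_on)
  show "(\<Sum>b\<in>Basis. N b)-lipschitz_on UNIV N"
  proof (rule lipschitz_onI)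
    fix x y :: "real ^ 'n"
    have bd: "N z \<le> (\<Sum>b\<in>Basis. N b) * norm z" for z
    proof -
      have "N z = N (\<Sum>b\<in>Basis. (z \<bullet> b) *\<^sub>R b)" by (simp add: euclidean_representation)
      also have "\<dots> \<le> (\<Sum>b\<in>Basis. N ((z \<bullet> b) *\<^sub>R b))" using N by (rule is_norm_sum) simp
      also have "\<dots> \<le> (\<Sum>b\<in>Basis. norm z * N b)"
        by (intro sum_mono)
          (simp add: is_norm_scale[OF N] mult_right_mono is_norm_nonneg[OF N] Basis_le_norm)
      finally show ?thesis by (simp add: sum_distrib_left mult.commute)
    qed
    have "N x \<le> N y + N (x - y)" "N y \<le> N x + N (y - x)"
      using N unfolding is_norm_def by (metis add_diff_cancel_left' diff_add_cancel add.commute)+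
    with bd[of "x - y"] bd[of "y - x"]
    show "dist (N x) (N y) \<le> (\<Sum>b\<in>Basis. N b) * dist x y"
      by (simp add: dist_norm abs_le_iff norm_minus_commute)
  qed (simp add: sum_nonneg is_norm_nonneg[OF N])
qed

lemma is_norm_measurable: "is_norm N \<Longrightarrow> N \<in> borel_measurable borel"
  by (intro borel_measurable_continuous_onI is_norm_continuous)

section \<open>Measures on a countable product\<close>

text \<open>Boxes with finitely many open, non-trivial sides are stable under intersection and generate the
  product $\sigma$-algebra. Open sides are what weak convergence can reach, since the indicator of
  an open set is a limit of continuous functions.\<close>

lemma measure_eq_open_boxes:
  fixes \<mu> \<nu> :: "('i::countable \<Rightarrow> 'b::second_countable_topology) measure"
  assumes sets: "sets \<mu> = sets borel" "sets \<nu> = sets borel" and "finite_measure \<mu>"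
    and eq: "\<And>U. (\<And>j. open (U j)) \<Longrightarrow> finite {j. U j \<noteq> UNIV} \<Longrightarrow>
               emeasure \<mu> {x. \<forall>j. x j \<in> U j} = emeasure \<nu> {x. \<forall>j. x j \<in> U j}"
  shows "\<mu> = \<nu>"
proof -
  define E :: "('i \<Rightarrow> 'b) set set"
    where "E = {{x. \<forall>j. x j \<in> U j} | U. (\<forall>j. open (U j)) \<and> finite {j. U j \<noteq> UNIV}}"
  have E_UNIV: "UNIV \<in> E" unfolding E_def by (rule CollectI, rule exI[of _ "\<lambda>_. UNIV"]) auto
  have gen: "sets borel = sigma_sets UNIV E"
  proof
    have "sets (Pi\<^sub>M UNIV (\<lambda>_::'i. borel :: 'b measure)) \<subseteq> sets (sigma UNIV E)"
    proof (rule sets_PiM_in_sets)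
      fix i :: 'i and A :: "'b set" assume A: "A \<in> sets borel"
      have "(\<lambda>x. x i) \<in> borel_measurable (sigma UNIV E)"
      proof (rule borel_measurableI)
        fix S :: "'b set" assume "open S"
        then have "{x. x i \<in> S} \<in> E" unfolding E_def
          by (intro CollectI exI[of _ "\<lambda>j. if j = i then S else UNIV"] conjI)
            (auto intro: finite_subset[of _ "{i}"])
        then show "(\<lambda>x. x i) -` S \<inter> space (sigma UNIV E) \<in> sets (sigma UNIV E)"
          by (simp add: vimage_def)
      qed
      then show "{x \<in> space (sigma UNIV E). x i \<in> A} \<in> sets (sigma UNIV E)"
        using A by (simp add: measurable_def vimage_def)
    qed (simp add: space_measure_of_conv)
    then show "sets borel \<subseteq> sigma_sets UNIV E" by (simp add: sets_PiM_equal_borel)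
    have "E \<subseteq> sets borel"
    proof
      fix B assume "B \<in> E"
      then obtain U where U: "\<And>j. open (U j)" and B: "B = {x. \<forall>j. x j \<in> U j}"
        unfolding E_def by auto
      have [measurable]: "U j \<in> sets borel" for j using U by auto
      show "B \<in> sets borel" unfolding B by measurable
    qed
    then show "sigma_sets UNIV E \<subseteq> sets borel"
      using sets.sigma_sets_subset[of E borel] by simp
  qed
  show ?thesis
  proof (rule measure_eqI_generator_eq[where \<Omega> = UNIV and E = E and A = "\<lambda>_. UNIV"])
    show "Int_stable E"
    proof (rule Int_stableI)
      fix A B assume "A \<in> E" "B \<in> E"
      then obtain U V where *: "\<And>j. open (U j)" "\<And>j. open (V j)"
        "finite {j. U j \<noteq> UNIV}" "finite {j. V j \<noteq> UNIV}"
        "A = {x. \<forall>j. x j \<in> U j}" "B = {x. \<forall>j. x j \<in> V j}"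
        unfolding E_def by auto
      then show "A \<inter> B \<in> E" unfolding E_def
        by (intro CollectI exI[of _ "\<lambda>j. U j \<inter> V j"] conjI)
          (auto intro: finite_subset[of _ "{j. U j \<noteq> UNIV} \<union> {j. V j \<noteq> UNIV}"])
    qed
    show "emeasure \<mu> X = emeasure \<nu> X" if "X \<in> E" for X using that eq unfolding E_def by auto
    show "emeasure \<mu> UNIV \<noteq> \<infinity>" using \<open>finite_measure \<mu>\<close>
      by (simp add: finite_measure.emeasure_finite)
  qed (use sets gen E_UNIV in auto)
qed

section \<open>Weak convergence and change of time on finite windows\<close>

text \<open>The functions \<open>cutoff n U\<close> are continuous, vanish off $U$ and increase to the indicator of the
  open set $U$. The whole space needs its own clause because the distance to the empty set is
  zero by convention.\<close>

definition cutoff :: "nat \<Rightarrow> 'a::metric_space set \<Rightarrow> 'a \<Rightarrow> real" where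
  "cutoff n U x = (if U = UNIV then 1 else min 1 (real n * infdist x (- U)))"

lemma cutoff_bounds: "0 \<le> cutoff n U x" "cutoff n U x \<le> 1"
  unfolding cutoff_def by (auto simp: infdist_nonneg)

lemma cutoff_outside: "x \<notin> U \<Longrightarrow> cutoff n U x = 0"
  unfolding cutoff_def by (auto simp: infdist_zero)

lemma infdist_complement_pos: "open U \<Longrightarrow> x \<in> U \<Longrightarrow> U \<noteq> UNIV \<Longrightarrow> infdist x (- U) > 0"
  using in_closed_iff_infdist_zero[of "- U" x] infdist_nonneg[of x "- U"]
  by (auto simp: closed_def less_le)

lemma cutoff_inside_pos: "open U \<Longrightarrow> x \<in> U \<Longrightarrow> n > 0 \<Longrightarrow> cutoff n U x > 0"
  unfolding cutoff_def using infdist_complement_pos[of U x] by auto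

lemma cutoff_continuous: "continuous_on UNIV (cutoff n U)"
  unfolding cutoff_def
  by (cases "U = UNIV") (auto intro!: continuous_intros)

lemma cutoff_tendsto:
  assumes "open U"
  shows "(\<lambda>n. cutoff n U x) \<longlonglongrightarrow> indicator U x"
proof (cases "x \<in> U \<and> U \<noteq> UNIV")
  case True
  then have pos: "infdist x (- U) > 0" using infdist_complement_pos[of U x] assms by auto
  obtain m where m: "1 < real m * infdist x (- U)" using reals_Archimedean3[OF pos] by blast
  have "cutoff n U x = 1" if "n \<ge> m" for n
  proof -
    have "real m * infdist x (- U) \<le> real n * infdist x (- U)"
      using that pos by (intro mult_right_mono) auto
    with m show ?thesis unfolding cutoff_def by auto
  qed
  then show ?thesis using True
    by (intro tendsto_eventually eventually_sequentiallyI[of m]) auto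
next
  case False
  then show ?thesis by (cases "x \<in> U") (auto simp: cutoff_outside, simp add: cutoff_def)
qed


locale tail_process_setting =
  fixes N :: "real ^ 'n \<Rightarrow> real" and \<alpha> :: real
    and M :: "'w measure" and X :: "int \<Rightarrow> 'w \<Rightarrow> real ^ 'n"
    and P :: "'v measure" and Y :: "int \<Rightarrow> 'v \<Rightarrow> real ^ 'n"
  assumes norm: "is_norm N" and alpha_pos: "\<alpha> > 0"
    and prob_M: "prob_space M" and stationary: "stationary_series M X"
    and prob_P: "prob_space P" and tail: "tail_process N \<alpha> M X P Y"
begin

sublocale M: prob_space M by (rule prob_M)
sublocale P: prob_space P by (rule prob_P)

lemma X_measurable [measurable]: "X j \<in> borel_measurable M"
  using stationary unfolding stationary_series_def by auto

lemma Y_measurable [measurable]: "Y j \<in> borel_measurable P"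
  using tail unfolding tail_process_def by auto

lemma N_measurable [measurable]: "N \<in> borel_measurable borel"
  by (rule is_norm_measurable[OF norm])

lemma X_sequence_measurable [measurable]: "(\<lambda>\<omega> j. X (f j) \<omega>) \<in> borel_measurable M" for f :: "int \<Rightarrow> int"
  by (rule measurable_coordinatewise_then_product) simp

lemma Y_sequence_measurable [measurable]: "(\<lambda>\<omega> j. Y j \<omega>) \<in> borel_measurable P"
  by (rule measurable_coordinatewise_then_product) simp

lemma radius: "1 \<le> y \<Longrightarrow> measure P {\<omega> \<in> space P. y < N (Y 0 \<omega>)} = y powr (- \<alpha>)"
  using tail unfolding tail_process_def by auto

lemma AE_radius: "AE \<omega> in P. 1 < N (Y 0 \<omega>)"
  using radius[of 1] by (subst P.prob_Collect_eq_1[symmetric]) auto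

abbreviation exceedance_prob :: "real \<Rightarrow> real" where
  "exceedance_prob u \<equiv> measure M {\<omega> \<in> space M. u < N (X 0 \<omega>)}"

abbreviation window_product ::
    "int \<Rightarrow> int \<Rightarrow> (int \<Rightarrow> real ^ 'n \<Rightarrow> real) \<Rightarrow> (int \<Rightarrow> real ^ 'n) \<Rightarrow> real" where
  "window_product s e g x \<equiv> (\<Prod>j\<in>{s..e}. g j (x j))"

text \<open>Products of functions of single coordinates are enough to identify a law. If the factor at $0$
  vanishes on the unit ball, the conditioning on $|X_0| > u$ is implicit in the product, so the
  conditional expectation is a plain expectation divided by $P(|X_0| > u)$.\<close>

lemma product_limit:
  assumes se: "s \<le> 0" "0 \<le> e"
    and cont: "\<And>j. continuous_on UNIV (g j)" and bds: "\<And>j x. 0 \<le> g j x" "\<And>j x. g j x \<le> 1"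
    and van: "\<And>x. N x \<le> 1 \<Longrightarrow> g 0 x = 0"
  shows "((\<lambda>u. (\<integral>\<omega>. window_product s e g (\<lambda>j. (1 / u) *\<^sub>R X j \<omega>) \<partial>M) / exceedance_prob u)
           \<longlongrightarrow> (\<integral>\<omega>. window_product s e g (\<lambda>j. Y j \<omega>) \<partial>P)) at_top"
proof -
  have [measurable]: "g j \<in> borel_measurable borel" for j
    by (intro borel_measurable_continuous_onI cont)
  define f where "f = window_product s e g"
  have f_window: "f (window s e x) = window_product s e g x" for x
    unfolding f_def window_def by (auto intro!: prod.cong)
  have f_cont: "continuous_map (window_topology s e) euclideanreal f"
    unfolding f_def window_topology_def
  proof (rule continuous_map_prod)
    fix j assume j: "j \<in> {s..e}"
    have "continuous_map (product_topology (\<lambda>_. euclidean) {s..e}) euclideanreal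
            (g j \<circ> (\<lambda>x::int \<Rightarrow> real ^ 'n. x j))"
      using cont[of j] j by (intro continuous_map_compose[OF continuous_map_product_projection])
        auto
    then show "continuous_map (product_topology (\<lambda>_. euclidean) {s..e}) euclideanreal
            (\<lambda>x::int \<Rightarrow> real ^ 'n. g j (x j))" by (simp add: o_def)
  qed simp
  have f_range: "0 \<le> f x" "f x \<le> 1" for x
    unfolding f_def by (auto intro!: prod_nonneg prod_le_1 bds)
  have f_bdd: "bounded (f ` T)" for T
    by (rule bounded_subset[of "{0..1}"]) (use f_range in auto)
  have se': "s \<le> e" using se by simp
  let ?A = "\<lambda>u. {\<omega> \<in> space M. u < N (X 0 \<omega>)}"
  have lim: "((\<lambda>u. \<integral>\<omega>. h (window s e (\<lambda>j. (1 / u) *\<^sub>R X j \<omega>)) \<partial>(uniform_measure M (?A u)))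
          \<longlongrightarrow> (\<integral>\<omega>. h (window s e (\<lambda>j. Y j \<omega>)) \<partial>P)) at_top"
    if "continuous_map (window_topology s e) euclideanreal h" "\<And>T. bounded (h ` T)" for h
    using tail se' that unfolding tail_process_def by blast
  \<comment> \<open>The constant test function shows that the conditioning events eventually have positive
    probability; otherwise the conditional measure would be the zero measure.\<close>
  have "((\<lambda>u. measure (uniform_measure M (?A u)) (space M)) \<longlongrightarrow> 1) at_top"
    using lim[of "\<lambda>_. 1", OF _ bounded_subset[of "{1}"]] by (force simp: P.prob_space)
  then have "eventually (\<lambda>u. measure (uniform_measure M (?A u)) (space M) > 0) at_top"
    by (rule order_tendstoD) simp
  then have "eventually (\<lambda>u. (\<integral>\<omega>. f (window s e (\<lambda>j. (1 / u) *\<^sub>R X j \<omega>)) \<partial>(uniform_measure M (?A u)))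
       = (\<integral>\<omega>. window_product s e g (\<lambda>j. (1 / u) *\<^sub>R X j \<omega>) \<partial>M) / exceedance_prob u) at_top"
    using eventually_gt_at_top[of 0]
  proof eventually_elim
    case (elim u)
    have pos: "emeasure M (?A u) > 0"
    proof (rule ccontr)
      assume "\<not> emeasure M (?A u) > 0"
      then have "emeasure (uniform_measure M (?A u)) (space M) = 0"
        by (subst emeasure_uniform_measure) (auto simp: Int_absorb2)
      with elim show False by (simp add: measure_def)
    qed
    have p: "exceedance_prob u > 0" using pos by (simp add: M.emeasure_eq_measure)
    have "(\<integral>\<omega>. f (window s e (\<lambda>j. (1 / u) *\<^sub>R X j \<omega>)) \<partial>(uniform_measure M (?A u)))
       = (\<integral>\<omega>. window_product s e g (\<lambda>j. (1 / u) *\<^sub>R X j \<omega>)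
            \<partial>(density M (\<lambda>\<omega>. ennreal (indicator (?A u) \<omega> / exceedance_prob u))))"
      unfolding f_window uniform_measure_def
      using p by (intro arg_cong2[where f = "integral\<^sup>L"] refl density_cong)
        (auto simp: M.emeasure_eq_measure divide_ennreal[symmetric] ennreal_indicator)
    also have "\<dots> = (\<integral>\<omega>. (indicator (?A u) \<omega> / exceedance_prob u) *\<^sub>R
         window_product s e g (\<lambda>j. (1 / u) *\<^sub>R X j \<omega>) \<partial>M)"
      by (intro integral_density) (auto intro!: divide_nonneg_nonneg)
    also have "\<dots> = (\<integral>\<omega>. window_product s e g (\<lambda>j. (1 / u) *\<^sub>R X j \<omega>) / exceedance_prob u \<partial>M)"
    proof (intro Bochner_Integration.integral_cong refl)
      fix \<omega> assume \<omega>: "\<omega> \<in> space M"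
      show "(indicator (?A u) \<omega> / exceedance_prob u) *\<^sub>R window_product s e g (\<lambda>j. (1 / u) *\<^sub>R X j \<omega>)
         = window_product s e g (\<lambda>j. (1 / u) *\<^sub>R X j \<omega>) / exceedance_prob u"
      proof (cases "\<omega> \<in> ?A u")
        case False
        then have "g 0 ((1 / u) *\<^sub>R X 0 \<omega>) = 0"
          using elim \<omega> by (intro van) (auto simp: is_norm_scale[OF norm] divide_simps)
        then have "window_product s e g (\<lambda>j. (1 / u) *\<^sub>R X j \<omega>) = 0"
          using se by (intro prod_zero) auto
        then show ?thesis by simp
      qed simp
    qed
    finally show ?case by simp
  qed
  from Lim_transform_eventually[OF lim[OF f_cont f_bdd] this] show ?thesis
    unfolding f_window .
qed

lemma integral_stationary:
  assumes [measurable]: "F \<in> borel_measurable borel"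
  shows "(\<integral>\<omega>. F (\<lambda>j. X (j + h) \<omega>) \<partial>M) = (\<integral>\<omega>. F (\<lambda>j. X j \<omega>) \<partial>M :: real)"
proof -
  have "(\<integral>\<omega>. F (\<lambda>j. X (j + h) \<omega>) \<partial>M) = (\<integral>x. F x \<partial>(distr M borel (\<lambda>\<omega> j. X (j + h) \<omega>)))"
    by (rule integral_distr[symmetric]) measurable
  also have "\<dots> = (\<integral>x. F x \<partial>(distr M borel (\<lambda>\<omega> j. X j \<omega>)))"
    using stationary unfolding stationary_series_def by simp
  also have "\<dots> = (\<integral>\<omega>. F (\<lambda>j. X j \<omega>) \<partial>M)"
    by (rule integral_distr) measurable
  finally show ?thesis .
qed

text \<open>The unnormalized expectations are the same as in \<open>product_limit\<close>, but after a shift by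
  stationarity the conditioning is carried by the coordinate $i$, at the level $tu$. Hence the
  normalization is $P(|X_0| > tu)$ and the limit involves $t B^i Y$.\<close>

lemma shifted_product_limit:
  assumes t: "t > 0" and si: "s \<le> i" "i \<le> e"
    and cont: "\<And>j. continuous_on UNIV (g j)" and bds: "\<And>j x. 0 \<le> g j x" "\<And>j x. g j x \<le> 1"
    and van: "\<And>x. N x \<le> t \<Longrightarrow> g i x = 0"
  shows "((\<lambda>u. (\<integral>\<omega>. window_product s e g (\<lambda>j. (1 / u) *\<^sub>R X j \<omega>) \<partial>M) / exceedance_prob (t * u))
           \<longlongrightarrow> (\<integral>\<omega>. window_product s e g (\<lambda>j. t *\<^sub>R Y (j - i) \<omega>) \<partial>P)) at_top"
proof -
  have [measurable]: "g j \<in> borel_measurable borel" for j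
    by (intro borel_measurable_continuous_onI cont)
  define g' where "g' k x = g (k + i) (t *\<^sub>R x)" for k x
  have reindex: "window_product (s - i) (e - i) g' x = window_product s e g (\<lambda>j. t *\<^sub>R x (j - i))" for x
    unfolding g'_def
    by (rule prod.reindex_bij_witness[of _ "\<lambda>j. j - i" "\<lambda>k. k + i"]) auto
  have "((\<lambda>v. (\<integral>\<omega>. window_product (s - i) (e - i) g' (\<lambda>j. (1 / v) *\<^sub>R X j \<omega>) \<partial>M) / exceedance_prob v)
           \<longlongrightarrow> (\<integral>\<omega>. window_product (s - i) (e - i) g' (\<lambda>j. Y j \<omega>) \<partial>P)) at_top"
  proof (rule product_limit)
    show "continuous_on UNIV (g' j)" for j
      unfolding g'_def by (intro continuous_on_compose2[OF cont] continuous_intros) auto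
    show "g' 0 x = 0" if "N x \<le> 1" for x
      unfolding g'_def using that t by (auto intro!: van simp: is_norm_scale[OF norm])
  qed (use si bds in \<open>auto simp: g'_def\<close>)
  moreover have "filterlim (\<lambda>u. t * u) at_top at_top"
    using t by (simp add: filterlim_tendsto_pos_mult_at_top[OF tendsto_const _ filterlim_ident])
  ultimately have lim: "((\<lambda>u. (\<integral>\<omega>. window_product (s - i) (e - i) g' (\<lambda>j. (1 / (t * u)) *\<^sub>R X j \<omega>) \<partial>M)
        / exceedance_prob (t * u))
           \<longlongrightarrow> (\<integral>\<omega>. window_product (s - i) (e - i) g' (\<lambda>j. Y j \<omega>) \<partial>P)) at_top"
    by (rule filterlim_compose)
  have "(\<integral>\<omega>. window_product (s - i) (e - i) g' (\<lambda>j. (1 / (t * u)) *\<^sub>R X j \<omega>) \<partial>M)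
     = (\<integral>\<omega>. window_product s e g (\<lambda>j. (1 / u) *\<^sub>R X j \<omega>) \<partial>M)" for u
  proof -
    have "(\<integral>\<omega>. window_product (s - i) (e - i) g' (\<lambda>j. (1 / (t * u)) *\<^sub>R X j \<omega>) \<partial>M)
       = (\<integral>\<omega>. window_product s e g (\<lambda>j. (1 / u) *\<^sub>R X (j - i) \<omega>) \<partial>M)"
      unfolding reindex using t by simp
    also have "\<dots> = (\<integral>\<omega>. window_product s e g (\<lambda>j. (1 / u) *\<^sub>R X j \<omega>) \<partial>M)"
      using integral_stationary[of "\<lambda>x. window_product s e g (\<lambda>j. (1 / u) *\<^sub>R x j)" "- i"]
      by simp
    finally show ?thesis .
  qed
  with lim show ?thesis unfolding reindex by simp
qed

lemma open_exceedance: "open {x. t < N x}"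
  using is_norm_continuous[OF norm] by (intro open_Collect_less) auto

text \<open>Comparing the two limits above for one product with a positive limit shows that the ratio converges
  to some constant; letting the product increase to the indicator of $\{|x_0| > 1\}$ identifies the
  constant through the Pareto law of $|Y_0|$.\<close>

lemma exceedance_ratio:
  assumes t: "0 < t" "t \<le> 1"
  shows "((\<lambda>u. exceedance_prob (t * u) / exceedance_prob u) \<longlongrightarrow> t powr (- \<alpha>)) at_top"
proof -
  let ?U = "{x. 1 < N x}"
  define A where "A n = (\<integral>\<omega>. cutoff n ?U (Y 0 \<omega>) \<partial>P)" for n
  define B where "B n = (\<integral>\<omega>. cutoff n ?U (t *\<^sub>R Y 0 \<omega>) \<partial>P)" for n
  define a where "a n u = (\<integral>\<omega>. cutoff n ?U ((1 / u) *\<^sub>R X 0 \<omega>) \<partial>M)" for n u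
  have [measurable]: "cutoff n U \<in> borel_measurable borel" for n and U :: "(real ^ 'n) set"
    by (intro borel_measurable_continuous_onI cutoff_continuous)
  have limA: "((\<lambda>u. a n u / exceedance_prob u) \<longlongrightarrow> A n) at_top" for n
    using product_limit[of 0 0 "\<lambda>_. cutoff n ?U"]
    by (simp add: cutoff_continuous cutoff_bounds cutoff_outside a_def A_def)
  have limB: "((\<lambda>u. a n u / exceedance_prob (t * u)) \<longlongrightarrow> B n) at_top" for n
    using shifted_product_limit[of t 0 0 0 "\<lambda>_. cutoff n ?U"] t
    by (simp add: cutoff_continuous cutoff_bounds cutoff_outside a_def B_def)
  have prob_scaled: "measure P {\<omega> \<in> space P. 1 < t * N (Y 0 \<omega>)} = t powr \<alpha>"
    using radius[of "1 / t"] t by (simp add: divide_simps powr_minus mult.commute powr_divide)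
  have bd: "integrable P (\<lambda>\<omega>. cutoff n ?U (c *\<^sub>R Y 0 \<omega>))" for n c
    by (rule P.integrable_const_bound[of _ 1]) (auto simp: cutoff_bounds)
  have posB: "B 1 > 0"
  proof -
    have "B 1 \<noteq> 0"
    proof
      assume "B 1 = 0"
      then have "AE \<omega> in P. cutoff 1 ?U (t *\<^sub>R Y 0 \<omega>) = 0"
        unfolding B_def using bd by (subst (asm) integral_nonneg_eq_0_iff_AE) (auto simp: cutoff_bounds)
      then have "AE \<omega> in P. \<not> (1 < t * N (Y 0 \<omega>))"
      proof eventually_elim
        case (elim \<omega>)
        then show ?case
          using cutoff_inside_pos[OF open_exceedance[of 1], of "t *\<^sub>R Y 0 \<omega>" 1] t
          by (auto simp: is_norm_scale[OF norm])
      qed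
      then have "measure P {\<omega> \<in> space P. 1 < t * N (Y 0 \<omega>)} = 0"
        by (subst P.prob_eq_0) auto
      with prob_scaled t show False by simp
    qed
    moreover have "B 1 \<ge> 0" unfolding B_def by (intro Bochner_Integration.integral_nonneg) (simp add: cutoff_bounds)
    ultimately show ?thesis by simp
  qed
  have lim: "((\<lambda>u. exceedance_prob (t * u) / exceedance_prob u) \<longlongrightarrow> A 1 / B 1) at_top"
  proof (rule Lim_transform_eventually)
    show "((\<lambda>u. (a 1 u / exceedance_prob u) / (a 1 u / exceedance_prob (t * u))) \<longlongrightarrow> A 1 / B 1) at_top"
      using limA limB posB by (intro tendsto_divide) auto
    have "eventually (\<lambda>u. a 1 u / exceedance_prob (t * u) > 0) at_top"
      using limB posB by (rule order_tendstoD)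
    then show "eventually (\<lambda>u. (a 1 u / exceedance_prob u) / (a 1 u / exceedance_prob (t * u))
        = exceedance_prob (t * u) / exceedance_prob u) at_top"
    proof eventually_elim
      case (elim u)
      then have "exceedance_prob (t * u) \<noteq> 0" by auto
      with elim show ?case by auto
    qed
  qed
  have AB: "A n = (A 1 / B 1) * B n" for n
  proof -
    have "((\<lambda>u. (exceedance_prob (t * u) / exceedance_prob u) * (a n u / exceedance_prob (t * u)))
       \<longlongrightarrow> (A 1 / B 1) * B n) at_top"
      using lim limB by (rule tendsto_mult)
    moreover have "eventually (\<lambda>u. a 1 u / exceedance_prob (t * u) > 0) at_top"
      using limB posB by (rule order_tendstoD)
    then have "eventually (\<lambda>u. (exceedance_prob (t * u) / exceedance_prob u) *
        (a n u / exceedance_prob (t * u)) = a n u / exceedance_prob u) at_top"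
    proof eventually_elim
      case (elim u)
      then have "exceedance_prob (t * u) \<noteq> 0" by auto
      with elim show ?case by auto
    qed
    ultimately have "((\<lambda>u. a n u / exceedance_prob u) \<longlongrightarrow> (A 1 / B 1) * B n) at_top"
      by (rule Lim_transform_eventually)
    with limA show ?thesis by (intro tendsto_unique[OF trivial_limit_at_top_linorder])
  qed
  have lim_cut: "(\<lambda>n. \<integral>\<omega>. cutoff n ?U (c *\<^sub>R Y 0 \<omega>) \<partial>P) \<longlonglongrightarrow> (\<integral>\<omega>. indicator ?U (c *\<^sub>R Y 0 \<omega>) \<partial>P)" for c
  proof (rule integral_dominated_convergence[where w = "\<lambda>_. 1"])
    show "AE \<omega> in P. (\<lambda>n. cutoff n ?U (c *\<^sub>R Y 0 \<omega>)) \<longlonglongrightarrow> indicator ?U (c *\<^sub>R Y 0 \<omega>)"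
      by (intro always_eventually allI cutoff_tendsto open_exceedance)
  qed (auto simp: cutoff_bounds)
  have ind: "(\<integral>\<omega>. indicator ?U (c *\<^sub>R Y 0 \<omega>) \<partial>P) = measure P {\<omega> \<in> space P. 1 < c * N (Y 0 \<omega>)}"
    if "c > 0" for c :: real
  proof -
    have "(\<integral>\<omega>. indicator ?U (c *\<^sub>R Y 0 \<omega>) \<partial>P) = (\<integral>\<omega>. indicator {\<omega> \<in> space P. 1 < c * N (Y 0 \<omega>)} \<omega> \<partial>P :: real)"
      using that by (intro Bochner_Integration.integral_cong) (auto simp: indicator_def is_norm_scale[OF norm])
    then show ?thesis by simp
  qed
  have "A \<longlonglongrightarrow> 1"
    using lim_cut[of 1] ind[of 1] radius[of 1] by (simp add: A_def[abs_def])
  moreover have "B \<longlonglongrightarrow> t powr \<alpha>"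
    using lim_cut[of t] ind[of t] prob_scaled t by (simp add: B_def[abs_def])
  then have "(\<lambda>n. (A 1 / B 1) * B n) \<longlonglongrightarrow> (A 1 / B 1) * t powr \<alpha>" by (intro tendsto_intros)
  then have "A \<longlonglongrightarrow> (A 1 / B 1) * t powr \<alpha>" 
    by (rule Lim_transform_eventually) (intro always_eventually allI AB[symmetric])
  ultimately have "1 = (A 1 / B 1) * t powr \<alpha>" by (rule LIMSEQ_unique)
  then have "inverse (t powr \<alpha>) = A 1 / B 1"
    by (intro inverse_unique) (simp only: mult.commute)
  then have "A 1 / B 1 = t powr (- \<alpha>)" by (simp only: powr_minus)
  with lim show ?thesis by simp
qed

text \<open>Divide the two limits above, then replace the continuous factors by indicators of open sets. The
  condition on the sides at $0$ and $i$ makes both normalizations available.\<close>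

lemma window_box_time_change:
  assumes t: "0 < t" "t \<le> 1" and se: "s \<le> 0" "0 \<le> e" "s \<le> i" "i \<le> e"
    and op: "\<And>j. open (U j)" and U: "U 0 \<subseteq> {x. 1 < N x}" "U i \<subseteq> {x. t < N x}"
  shows "measure P {\<omega> \<in> space P. \<forall>j\<in>{s..e}. Y j \<omega> \<in> U j}
    = t powr (- \<alpha>) * measure P {\<omega> \<in> space P. \<forall>j\<in>{s..e}. t *\<^sub>R Y (j - i) \<omega> \<in> U j}"
proof -
  have [measurable]: "cutoff n V \<in> borel_measurable borel" for n and V :: "(real ^ 'n) set"
    by (intro borel_measurable_continuous_onI cutoff_continuous)
  have [measurable]: "U j \<in> sets borel" for j using op by auto
  let ?g = "\<lambda>n j. cutoff n (U j)"
  have eq: "(\<integral>\<omega>. window_product s e (?g n) (\<lambda>j. Y j \<omega>) \<partial>P)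
      = t powr (- \<alpha>) * (\<integral>\<omega>. window_product s e (?g n) (\<lambda>j. t *\<^sub>R Y (j - i) \<omega>) \<partial>P)" for n
  proof -
    define a where "a u = (\<integral>\<omega>. window_product s e (?g n) (\<lambda>j. (1 / u) *\<^sub>R X j \<omega>) \<partial>M)" for u
    have lim1: "((\<lambda>u. a u / exceedance_prob u) \<longlongrightarrow>
        (\<integral>\<omega>. window_product s e (?g n) (\<lambda>j. Y j \<omega>) \<partial>P)) at_top"
      unfolding a_def using se U
      by (intro product_limit cutoff_bounds cutoff_continuous) (auto intro!: cutoff_outside)
    have lim2: "((\<lambda>u. a u / exceedance_prob (t * u)) \<longlongrightarrow>
        (\<integral>\<omega>. window_product s e (?g n) (\<lambda>j. t *\<^sub>R Y (j - i) \<omega>) \<partial>P)) at_top"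
      unfolding a_def using se U t
      by (intro shifted_product_limit cutoff_bounds cutoff_continuous) (auto intro!: cutoff_outside)
    have "((\<lambda>u. (exceedance_prob (t * u) / exceedance_prob u) * (a u / exceedance_prob (t * u))) \<longlongrightarrow>
        t powr (- \<alpha>) * (\<integral>\<omega>. window_product s e (?g n) (\<lambda>j. t *\<^sub>R Y (j - i) \<omega>) \<partial>P)) at_top"
      by (intro tendsto_mult exceedance_ratio t lim2)
    moreover have "eventually (\<lambda>u. exceedance_prob (t * u) / exceedance_prob u > 0) at_top"
      using exceedance_ratio[OF t] by (rule order_tendstoD) (use t in simp)
    then have "eventually (\<lambda>u. (exceedance_prob (t * u) / exceedance_prob u) *
        (a u / exceedance_prob (t * u)) = a u / exceedance_prob u) at_top"
    proof eventually_elim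
      case (elim u)
      then have "exceedance_prob (t * u) \<noteq> 0" by auto
      with elim show ?case by auto
    qed
    ultimately have "((\<lambda>u. a u / exceedance_prob u) \<longlongrightarrow>
        t powr (- \<alpha>) * (\<integral>\<omega>. window_product s e (?g n) (\<lambda>j. t *\<^sub>R Y (j - i) \<omega>) \<partial>P)) at_top"
      by (rule Lim_transform_eventually)
    with lim1 show ?thesis by (intro tendsto_unique[OF trivial_limit_at_top_linorder])
  qed
  have lim: "(\<lambda>n. \<integral>\<omega>. window_product s e (?g n) (\<lambda>j. Z j \<omega>) \<partial>P)
      \<longlonglongrightarrow> measure P {\<omega> \<in> space P. \<forall>j\<in>{s..e}. Z j \<omega> \<in> U j}"
    if Z[measurable]: "\<And>j. Z j \<in> borel_measurable P" for Z :: "int \<Rightarrow> 'v \<Rightarrow> real ^ 'n"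
  proof -
    have "(\<lambda>n. \<integral>\<omega>. window_product s e (?g n) (\<lambda>j. Z j \<omega>) \<partial>P)
       \<longlonglongrightarrow> (\<integral>\<omega>. (\<Prod>j\<in>{s..e}. indicator (U j) (Z j \<omega>)) \<partial>P)"
    proof (rule integral_dominated_convergence[where w = "\<lambda>_. 1"])
      show "AE \<omega> in P. (\<lambda>n. window_product s e (?g n) (\<lambda>j. Z j \<omega>))
          \<longlonglongrightarrow> (\<Prod>j\<in>{s..e}. indicator (U j) (Z j \<omega>))"
        by (intro always_eventually allI tendsto_prod cutoff_tendsto op)
    qed (auto simp: abs_prod intro!: prod_le_1 cutoff_bounds abs_of_nonneg simp: cutoff_bounds)
    also have "(\<integral>\<omega>. (\<Prod>j\<in>{s..e}. indicator (U j) (Z j \<omega>)) \<partial>P)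
      = (\<integral>\<omega>. indicator {\<omega> \<in> space P. \<forall>j\<in>{s..e}. Z j \<omega> \<in> U j} \<omega> \<partial>P :: real)"
    proof (intro Bochner_Integration.integral_cong refl)
      fix \<omega> assume "\<omega> \<in> space P"
      then show "(\<Prod>j\<in>{s..e}. indicator (U j) (Z j \<omega>))
          = (indicator {\<omega> \<in> space P. \<forall>j\<in>{s..e}. Z j \<omega> \<in> U j} \<omega> :: real)"
        by (cases "\<forall>j\<in>{s..e}. Z j \<omega> \<in> U j") (auto simp: indicator_def prod_zero_iff)
    qed
    finally show ?thesis by simp
  qed
  have "(\<lambda>n. t powr (- \<alpha>) * (\<integral>\<omega>. window_product s e (?g n) (\<lambda>j. t *\<^sub>R Y (j - i) \<omega>) \<partial>P))
      \<longlonglongrightarrow> t powr (- \<alpha>) * measure P {\<omega> \<in> space P. \<forall>j\<in>{s..e}. t *\<^sub>R Y (j - i) \<omega> \<in> U j}"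
    by (intro tendsto_mult tendsto_const lim) measurable
  moreover have "(\<lambda>n. \<integral>\<omega>. window_product s e (?g n) (\<lambda>j. Y j \<omega>) \<partial>P)
      \<longlonglongrightarrow> measure P {\<omega> \<in> space P. \<forall>j\<in>{s..e}. Y j \<omega> \<in> U j}"
    by (rule lim) measurable
  ultimately show ?thesis using eq by (simp add: LIMSEQ_unique)
qed

end

section \<open>The law of the tail process\<close>

text \<open>\<open>rescale t i y\<close> is $t B^i y$.\<close>

definition rescale :: "real \<Rightarrow> int \<Rightarrow> (int \<Rightarrow> real ^ 'n) \<Rightarrow> (int \<Rightarrow> real ^ 'n)" where
  "rescale t i y = (\<lambda>k. t *\<^sub>R y (k - i))"

lemma rescale_measurable [measurable]: "rescale t i \<in> borel_measurable borel"
  unfolding rescale_def by (rule measurable_coordinatewise_then_product) measurable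

text \<open>The law of a tail process, characterized by its time change formula. The last assumption is the
  convergence to zero, written with countably many quantifiers so that it is visibly a
  measurable event.\<close>

locale tail_law = prob_space L
  for L :: "(int \<Rightarrow> real ^ 'n) measure" and N :: "real ^ 'n \<Rightarrow> real" and \<alpha> :: real +
  assumes norm: "is_norm N" and alpha_pos: "\<alpha> > 0"
    and sets_L [measurable_cong, simp]: "sets L = sets borel"
    and radius: "1 \<le> r \<Longrightarrow> measure L {y. r < N (y 0)} = r powr (- \<alpha>)"
    and time_change: "\<And>t i F. 0 < t \<Longrightarrow> t \<le> 1 \<Longrightarrow> F \<in> borel_measurable borel \<Longrightarrow>
        (\<integral>\<^sup>+y. F y * indicator {y. t < N (y i)} y \<partial>L) =
        ennreal (t powr (- \<alpha>)) *
          (\<integral>\<^sup>+y. F (rescale t i y) * indicator {y. 1 < t * N (y (- i))} y \<partial>L)"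
    and vanishing: "AE y in L. \<forall>n::nat. \<exists>m::nat. \<forall>k. \<bar>k\<bar> > int m \<longrightarrow> N (y k) \<le> 1 / Suc n"

context tail_process_setting
begin

abbreviation law :: "(int \<Rightarrow> real ^ 'n) measure" where
  "law \<equiv> distr P borel (\<lambda>\<omega> j. Y j \<omega>)"

text \<open>Both sides define finite measures in $F$. On an open box they agree by
  \<open>window_box_time_change\<close>, because $|Y_0| > 1$ almost surely allows the side at $0$ to be
  intersected with $\{|x| > 1\}$.\<close>

lemma law_time_change:
  assumes t: "0 < t" "t \<le> 1" and F[measurable]: "F \<in> borel_measurable borel"
  shows "(\<integral>\<^sup>+y. F y * indicator {y. t < N (y i)} y \<partial>law) =
        ennreal (t powr (- \<alpha>)) *
          (\<integral>\<^sup>+y. F (rescale t i y) * indicator {y. 1 < t * N (y (- i))} y \<partial>law)"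
proof -
  interpret law: prob_space law by (rule P.prob_space_distr) measurable
  define \<mu> where "\<mu> = density law (indicator {y. t < N (y i)})"
  define \<nu>' where "\<nu>' = density law (\<lambda>y. ennreal (t powr (- \<alpha>)) * indicator {y. 1 < t * N (y (- i))} y)"
  define \<nu> where "\<nu> = distr \<nu>' borel (rescale t i)"
  have [measurable]: "{y :: int \<Rightarrow> real ^ 'n. c < d * N (y k)} \<in> sets borel" for c d k by measurable
  have [measurable]: "{y :: int \<Rightarrow> real ^ 'n. c < N (y k)} \<in> sets borel" for c k by measurable
  have [measurable_cong]: "sets \<nu>' = sets borel" unfolding \<nu>'_def by simp
  have "\<mu> = \<nu>"
  proof (rule measure_eq_open_boxes)
    show "sets \<mu> = sets borel" "sets \<nu> = sets borel" unfolding \<mu>_def \<nu>_def by simp_all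
    show "finite_measure \<mu>"
    proof
      have "emeasure \<mu> (space \<mu>) = (\<integral>\<^sup>+y. indicator {y. t < N (y i)} y * indicator (space \<mu>) y \<partial>law)"
        unfolding \<mu>_def by (rule emeasure_density) auto
      also have "\<dots> \<le> (\<integral>\<^sup>+y. 1 \<partial>law)"
        by (intro nn_integral_mono) (simp add: indicator_def)
      also have "\<dots> = 1" by (simp add: law.emeasure_space_1[simplified])
      finally show "emeasure \<mu> (space \<mu>) \<noteq> \<infinity>" by (auto simp: top_unique)
    qed
    fix U :: "int \<Rightarrow> (real ^ 'n) set" assume op: "\<And>j. open (U j)" and fin: "finite {j. U j \<noteq> UNIV}"
    have [measurable]: "U j \<in> sets borel" for j using op by auto
    have "finite ({j. U j \<noteq> UNIV} \<union> {0, i})" using fin by simp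
    then obtain b where b: "\<And>j. j \<in> {j. U j \<noteq> UNIV} \<union> {0, i} \<Longrightarrow> \<bar>j\<bar> \<le> b"
      using Max_ge[OF finite_imageI[of _ abs]] by (metis imageI)
    have b0: "0 \<le> b" and bi: "- b \<le> i" "i \<le> b" using b[of 0] b[of i] by auto
    \<comment> \<open>The constraints on the coordinates $0$ and $i$ are absorbed into the sides of the box.\<close>
    define V where "V j = U j \<inter> (if j = 0 then {x. 1 < N x} else UNIV) \<inter>
      (if j = i then {x. t < N x} else UNIV)" for j
    have opV: "open (V j)" for j unfolding V_def using op open_exceedance by (auto intro!: open_Int)
    have [measurable]: "V j \<in> sets borel" for j using opV by auto
    have all: "(\<forall>j\<in>{-b..b}. x j \<in> V j) \<longleftrightarrow> (\<forall>j. x j \<in> U j) \<and> 1 < N (x 0) \<and> t < N (x i)" for x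
    proof
      assume *: "\<forall>j\<in>{-b..b}. x j \<in> V j"
      have "x j \<in> U j" for j
      proof (cases "U j = UNIV")
        case False
        then have "j \<in> {-b..b}" using b[of j] by auto
        with * show ?thesis unfolding V_def by auto
      qed simp
      moreover have "x 0 \<in> V 0" "x i \<in> V i" using * b0 bi by auto
      then have "1 < N (x 0)" "t < N (x i)" unfolding V_def by auto
      ultimately show "(\<forall>j. x j \<in> U j) \<and> 1 < N (x 0) \<and> t < N (x i)" by simp
    qed (auto simp: V_def)
    let ?B = "{x. \<forall>j. x j \<in> U j}"
    have B[measurable]: "?B \<in> sets borel" by measurable
    have "emeasure \<mu> ?B = (\<integral>\<^sup>+y. indicator {y. t < N (y i)} y * indicator ?B y \<partial>law)"
      unfolding \<mu>_def by (subst emeasure_density) auto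
    also have "\<dots> = (\<integral>\<^sup>+\<omega>. indicator {y. t < N (y i)} (\<lambda>j. Y j \<omega>) * indicator ?B (\<lambda>j. Y j \<omega>) \<partial>P)"
      by (subst nn_integral_distr) auto
    also have "\<dots> = (\<integral>\<^sup>+\<omega>. indicator {\<omega> \<in> space P. \<forall>j\<in>{-b..b}. Y j \<omega> \<in> V j} \<omega> \<partial>P)"
      using AE_radius AE_space
      by (intro nn_integral_cong_AE, eventually_elim) (auto simp: all indicator_def)
    also have "\<dots> = ennreal (measure P {\<omega> \<in> space P. \<forall>j\<in>{-b..b}. Y j \<omega> \<in> V j})"
      by (simp add: P.emeasure_eq_measure)
    also have "\<dots> = ennreal (t powr (- \<alpha>) *
        measure P {\<omega> \<in> space P. \<forall>j\<in>{-b..b}. t *\<^sub>R Y (j - i) \<omega> \<in> V j})"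
      using t b0 bi opV by (subst window_box_time_change[where i = i]) (auto simp: V_def)
    also have "\<dots> = ennreal (t powr (- \<alpha>)) *
        (\<integral>\<^sup>+\<omega>. indicator {\<omega> \<in> space P. \<forall>j\<in>{-b..b}. t *\<^sub>R Y (j - i) \<omega> \<in> V j} \<omega> \<partial>P)"
      by (simp add: P.emeasure_eq_measure ennreal_mult)
    also have "\<dots> = ennreal (t powr (- \<alpha>)) * (\<integral>\<^sup>+\<omega>. indicator ?B (rescale t i (\<lambda>j. Y j \<omega>)) *
        indicator {y. 1 < t * N (y (- i))} (\<lambda>j. Y j \<omega>) \<partial>P)"
      using AE_radius AE_space[of P]
      by (intro arg_cong2[where f = "(*)"] refl nn_integral_cong_AE, eventually_elim)
        (use t in \<open>auto simp: all[of "\<lambda>j. t *\<^sub>R Y (j - i) _"] indicator_def rescale_def is_norm_scale[OF norm]\<close>)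
    also have "\<dots> = ennreal (t powr (- \<alpha>)) * (\<integral>\<^sup>+y. indicator ?B (rescale t i y) *
        indicator {y. 1 < t * N (y (- i))} y \<partial>law)"
      by (subst nn_integral_distr) auto
    also have "\<dots> = (\<integral>\<^sup>+y. ennreal (t powr (- \<alpha>)) * (indicator ?B (rescale t i y) *
        indicator {y. 1 < t * N (y (- i))} y) \<partial>law)"
      by (rule nn_integral_cmult[symmetric]) measurable
    also have "\<dots> = (\<integral>\<^sup>+y. indicator ?B (rescale t i y) \<partial>\<nu>')"
      unfolding \<nu>'_def by (subst nn_integral_density) (auto simp: mult_ac)
    also have "\<dots> = (\<integral>\<^sup>+y. indicator ?B y \<partial>\<nu>)"
      unfolding \<nu>_def by (subst nn_integral_distr) auto
    also have "\<dots> = emeasure \<nu> ?B" unfolding \<nu>_def by simp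
    finally show "emeasure \<mu> ?B = emeasure \<nu> ?B" .
  qed
  have "(\<integral>\<^sup>+y. F y * indicator {y. t < N (y i)} y \<partial>law) = (\<integral>\<^sup>+y. F y \<partial>\<mu>)"
    unfolding \<mu>_def by (subst nn_integral_density) (auto simp: mult.commute)
  also have "\<dots> = (\<integral>\<^sup>+y. F y \<partial>\<nu>)" using \<open>\<mu> = \<nu>\<close> by simp
  also have "\<dots> = (\<integral>\<^sup>+y. F (rescale t i y) \<partial>\<nu>')"
    unfolding \<nu>_def by (subst nn_integral_distr) auto
  also have "\<dots> = (\<integral>\<^sup>+y. ennreal (t powr (- \<alpha>)) * (F (rescale t i y) * indicator {y. 1 < t * N (y (- i))} y) \<partial>law)"
    unfolding \<nu>'_def by (subst nn_integral_density) (auto simp: mult_ac)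
  also have "\<dots> = ennreal (t powr (- \<alpha>)) *
          (\<integral>\<^sup>+y. F (rescale t i y) * indicator {y. 1 < t * N (y (- i))} y \<partial>law)"
    by (rule nn_integral_cmult) measurable
  finally show ?thesis .
qed


lemma tail_law_law:
  assumes van: "AE \<omega> in P. ((\<lambda>t. N (Y t \<omega>)) \<longlongrightarrow> 0) (filtercomap (\<lambda>t::int. \<bar>t\<bar>) at_top)"
  shows "tail_law law N \<alpha>"
proof -
  interpret law: prob_space law by (rule P.prob_space_distr) measurable
  show ?thesis
  proof
    show "is_norm N" "\<alpha> > 0" by (rule norm, rule alpha_pos)
    show "sets law = sets borel" by simp
    show "measure law {y. r < N (y 0)} = r powr (- \<alpha>)" if "1 \<le> r" for r
      using radius[OF that] by (subst measure_distr) (auto simp: vimage_def Int_def conj_commute)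
    show "AE y in law. \<forall>n::nat. \<exists>m::nat. \<forall>k. \<bar>k\<bar> > int m \<longrightarrow> N (y k) \<le> 1 / Suc n"
    proof (subst AE_distr_iff)
      show "AE \<omega> in P. \<forall>n::nat. \<exists>m::nat. \<forall>k. \<bar>k\<bar> > int m \<longrightarrow> N (Y k \<omega>) \<le> 1 / Suc n"
        using van
      proof eventually_elim
        case (elim \<omega>)
        show ?case
        proof
          fix n
          have "eventually (\<lambda>k. N (Y k \<omega>) < 1 / Suc n) (filtercomap (\<lambda>t::int. \<bar>t\<bar>) at_top)"
            using elim by (rule order_tendstoD) simp
          then obtain c where c: "\<And>k. \<bar>k\<bar> \<ge> c \<Longrightarrow> N (Y k \<omega>) < 1 / Suc n"
            by (auto simp: eventually_filtercomap_at_top_linorder)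
          show "\<exists>m::nat. \<forall>k. \<bar>k\<bar> > int m \<longrightarrow> N (Y k \<omega>) \<le> 1 / Suc n"
            by (intro exI[of _ "nat c"] allI impI less_imp_le c) linarith
        qed
      qed
    qed measurable
  qed (rule law_time_change)
qed

end

section \<open>First and last exceedances\<close>

lemma sup_norm_le_1: "sup_norm N J y \<le> 1 \<longleftrightarrow> (\<forall>j\<in>J. N (y j) \<le> 1)"
  unfolding sup_norm_def by (simp add: SUP_le_iff)

definition exceeds :: "(real ^ 'n \<Rightarrow> real) \<Rightarrow> real \<Rightarrow> (int \<Rightarrow> real ^ 'n) \<Rightarrow> int set" where
  "exceeds N t y = {k. 1 < t * N (y k)}"

definition first_exceedance :: "(real ^ 'n \<Rightarrow> real) \<Rightarrow> real \<Rightarrow> int \<Rightarrow> (int \<Rightarrow> real ^ 'n) set" where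
  "first_exceedance N t j = {y. 1 < t * N (y j) \<and> (\<forall>k<j. t * N (y k) \<le> 1)}"

definition last_exceedance :: "(real ^ 'n \<Rightarrow> real) \<Rightarrow> real \<Rightarrow> int \<Rightarrow> (int \<Rightarrow> real ^ 'n) set" where
  "last_exceedance N t j = {y. 1 < t * N (y j) \<and> (\<forall>k>j. t * N (y k) \<le> 1)}"

lemma nn_integral_count_space_unique:
  assumes "x \<in> A" "\<And>y. y \<in> A \<Longrightarrow> y = x"
  shows "(\<integral>\<^sup>+j. indicator A j \<partial>count_space UNIV) = (1::ennreal)"
proof -
  have A: "A = {x}" using assms by blast
  show ?thesis unfolding A using nn_integral_indicator[of "{x}" "count_space UNIV"] by simp
qed

text \<open>A sequence that exceeds the level at least once but only finitely often has exactly one first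
  exceedance.\<close>

lemma sum_first_exceedance:
  assumes "finite (exceeds N t y)"
  shows "(\<integral>\<^sup>+j. indicator (first_exceedance N t j) y \<partial>count_space UNIV) = (indicator {y. exceeds N t y \<noteq> {}} y :: ennreal)"
proof (cases "exceeds N t y = {}")
  case False
  have "(\<integral>\<^sup>+j. indicator {j. y \<in> first_exceedance N t j} j \<partial>count_space UNIV) = (1::ennreal)"
  proof (rule nn_integral_count_space_unique)
    show "Min (exceeds N t y) \<in> {j. y \<in> first_exceedance N t j}"
      using Min_in[OF assms False] Min_le[OF assms]
      unfolding first_exceedance_def exceeds_def by (force simp: not_less[symmetric])
    show "j = Min (exceeds N t y)" if "j \<in> {j. y \<in> first_exceedance N t j}" for j
      using that assms by (intro Min_eqI[symmetric])
        (auto simp: first_exceedance_def exceeds_def not_less[symmetric])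
  qed
  with False show ?thesis by (simp add: indicator_def)
next
  case True
  then have "y \<notin> first_exceedance N t j" for j unfolding first_exceedance_def exceeds_def by auto
  with True show ?thesis by (simp add: indicator_def)
qed

text \<open>Time reversal of \<open>sum_first_exceedance\<close>.\<close>

lemma sum_last_exceedance:
  assumes "finite (exceeds N t y)"
  shows "(\<integral>\<^sup>+j. indicator (last_exceedance N t j) y \<partial>count_space UNIV) = (indicator {y. exceeds N t y \<noteq> {}} y :: ennreal)"
proof -
  have *: "exceeds N t (\<lambda>k. y (- k)) = uminus ` exceeds N t y"
    unfolding exceeds_def by (auto simp: image_iff) (metis minus_minus)
  have "last_exceedance N t (- j) = {y. (\<lambda>k. y (- k)) \<in> first_exceedance N t j}" for j
    unfolding first_exceedance_def last_exceedance_def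
    by (auto simp: minus_less_iff)
  then have "(\<integral>\<^sup>+j. indicator (last_exceedance N t (- j)) y \<partial>count_space UNIV) =
     (\<integral>\<^sup>+j. indicator (first_exceedance N t j) (\<lambda>k. y (- k)) \<partial>count_space UNIV)"
    by (simp add: indicator_def)
  also have "\<dots> = indicator {y. exceeds N t y \<noteq> {}} y"
    using assms by (subst sum_first_exceedance) (auto simp: * indicator_def)
  finally show ?thesis
    by (subst (asm) nn_integral_bij_count_space[OF bij_uminus]) simp
qed

context tail_law
begin

lemma N_measurable [measurable]: "N \<in> borel_measurable borel"
  by (rule is_norm_measurable[OF norm])

lemma space_L [simp]: "space L = UNIV"
  using sets_eq_imp_space_eq[OF sets_L] by simp

lemma first_exceedance_sets [measurable]: "first_exceedance N t j \<in> sets borel"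
  unfolding first_exceedance_def by measurable

lemma last_exceedance_sets [measurable]: "last_exceedance N t j \<in> sets borel"
  unfolding last_exceedance_def by measurable

lemma AE_radius: "AE y in L. 1 < N (y 0)"
  using radius[of 1] by (subst prob_Collect_eq_1[symmetric]) auto

lemma AE_finite_exceeds: "AE y in L. \<forall>t>0. finite (exceeds N t y)"
  using vanishing
proof eventually_elim
  case (elim y)
  show ?case
  proof (intro allI impI)
    fix t :: real assume t: "t > 0"
    obtain n where n: "t < real (Suc n)" using reals_Archimedean2 by (metis lessI less_trans of_nat_less_iff)
    obtain m where m: "\<And>k. \<bar>k\<bar> > int m \<Longrightarrow> N (y k) \<le> 1 / Suc n" using elim by blast
    have "exceeds N t y \<subseteq> {- int m..int m}"
    proof
      fix k assume "k \<in> exceeds N t y"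
      then have k: "1 < t * N (y k)" unfolding exceeds_def by simp
      show "k \<in> {- int m..int m}"
      proof (rule ccontr)
        assume "k \<notin> {- int m..int m}"
        then have "N (y k) \<le> 1 / Suc n" by (intro m) auto
        then have "t * N (y k) \<le> t * (1 / Suc n)" using t by (intro mult_left_mono) auto
        also have "\<dots> < 1" using n by simp
        finally show False using k by simp
      qed
    qed
    then show "finite (exceeds N t y)" by (rule finite_subset) simp
  qed
qed

text \<open>Decompose the event of no exceedance after $0$ by the position $k$ of the first exceedance, and the
  event of no exceedance before $0$ by the position of the last one. The time change with $t = 1$ and
  $i = k$ moves a path whose exceedances span $[0,k]$ to one whose exceedances span $[-k,0]$.\<close>

lemma extremal_index_symmetric:
  "measure L {y. sup_norm N {1..} y \<le> 1} = measure L {y. sup_norm N {..-1} y \<le> 1}"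
proof -
  have cyl: "{y. sup_norm N J y \<le> 1} \<in> sets borel" for J :: "int set"
    unfolding sup_norm_le_1 by measurable
  have A1: "emeasure L {y. sup_norm N {1..} y \<le> 1} =
      (\<integral>\<^sup>+k. emeasure L (first_exceedance N 1 k \<inter> last_exceedance N 1 0) \<partial>count_space UNIV)"
  proof -
    have "emeasure L {y. sup_norm N {1..} y \<le> 1} = (\<integral>\<^sup>+y. indicator {y. sup_norm N {1..} y \<le> 1} y \<partial>L)"
      using cyl by simp
    also have "\<dots> = (\<integral>\<^sup>+y. (\<integral>\<^sup>+k. indicator (first_exceedance N 1 k \<inter> last_exceedance N 1 0) y \<partial>count_space UNIV) \<partial>L)"
      using AE_radius AE_finite_exceeds
    proof (intro nn_integral_cong_AE, eventually_elim)
      case (elim y)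
      have "(\<integral>\<^sup>+k. indicator (first_exceedance N 1 k \<inter> last_exceedance N 1 0) y \<partial>count_space UNIV)
        = (\<integral>\<^sup>+k. indicator (last_exceedance N 1 0) y * indicator (first_exceedance N 1 k) y \<partial>count_space UNIV)"
        by (intro nn_integral_cong) (simp add: indicator_inter_arith mult.commute)
      also have "\<dots> = indicator (last_exceedance N 1 0) y * indicator {y. exceeds N 1 y \<noteq> {}} y"
        using elim by (subst nn_integral_cmult) (auto simp: sum_first_exceedance)
      also have "\<dots> = indicator {y. sup_norm N {1..} y \<le> 1} y"
        using elim unfolding sup_norm_le_1 by (auto simp: indicator_def last_exceedance_def exceeds_def)
      finally show ?case by simp
    qed
    also have "\<dots> = (\<integral>\<^sup>+k. (\<integral>\<^sup>+y. indicator (first_exceedance N 1 k \<inter> last_exceedance N 1 0) y \<partial>L) \<partial>count_space UNIV)"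
      by (rule nn_integral_count_space_nn_integral) auto
    finally show ?thesis by simp
  qed
  have A2: "emeasure L {y. sup_norm N {..-1} y \<le> 1} =
      (\<integral>\<^sup>+k. emeasure L (first_exceedance N 1 0 \<inter> last_exceedance N 1 k) \<partial>count_space UNIV)"
  proof -
    have "emeasure L {y. sup_norm N {..-1} y \<le> 1} = (\<integral>\<^sup>+y. indicator {y. sup_norm N {..-1} y \<le> 1} y \<partial>L)"
      using cyl by simp
    also have "\<dots> = (\<integral>\<^sup>+y. (\<integral>\<^sup>+k. indicator (first_exceedance N 1 0 \<inter> last_exceedance N 1 k) y \<partial>count_space UNIV) \<partial>L)"
      using AE_radius AE_finite_exceeds
    proof (intro nn_integral_cong_AE, eventually_elim)
      case (elim y)
      have "(\<integral>\<^sup>+k. indicator (first_exceedance N 1 0 \<inter> last_exceedance N 1 k) y \<partial>count_space UNIV)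
        = (\<integral>\<^sup>+k. indicator (first_exceedance N 1 0) y * indicator (last_exceedance N 1 k) y \<partial>count_space UNIV)"
        by (intro nn_integral_cong) (simp add: indicator_inter_arith mult.commute)
      also have "\<dots> = indicator (first_exceedance N 1 0) y * indicator {y. exceeds N 1 y \<noteq> {}} y"
        using elim by (subst nn_integral_cmult) (auto simp: sum_last_exceedance)
      also have "\<dots> = indicator {y. sup_norm N {..-1} y \<le> 1} y"
        using elim unfolding sup_norm_le_1 by (auto simp: indicator_def first_exceedance_def exceeds_def)
      finally show ?case by simp
    qed
    also have "\<dots> = (\<integral>\<^sup>+k. (\<integral>\<^sup>+y. indicator (first_exceedance N 1 0 \<inter> last_exceedance N 1 k) y \<partial>L) \<partial>count_space UNIV)"
      by (rule nn_integral_count_space_nn_integral) auto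
    finally show ?thesis by simp
  qed
  have shift: "emeasure L (first_exceedance N 1 0 \<inter> last_exceedance N 1 k)
      = emeasure L (first_exceedance N 1 (- k) \<inter> last_exceedance N 1 0)" for k
  proof -
    have "emeasure L (first_exceedance N 1 0 \<inter> last_exceedance N 1 k)
        = (\<integral>\<^sup>+y. indicator (first_exceedance N 1 0 \<inter> last_exceedance N 1 k) y * indicator {y. 1 < N (y k)} y \<partial>L)"
      by (subst nn_integral_indicator[symmetric], measurable, intro nn_integral_cong)
        (auto simp: indicator_def last_exceedance_def)
    also have "\<dots> = (\<integral>\<^sup>+y. indicator (first_exceedance N 1 0 \<inter> last_exceedance N 1 k) (rescale 1 k y) *
        indicator {y. 1 < N (y (- k))} y \<partial>L)"
      using time_change[of 1 "indicator (first_exceedance N 1 0 \<inter> last_exceedance N 1 k)" k] by simp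
    also have "\<dots> = (\<integral>\<^sup>+y. indicator (first_exceedance N 1 (- k) \<inter> last_exceedance N 1 0) y \<partial>L)"
    proof (intro nn_integral_cong)
      fix y :: "int \<Rightarrow> real ^ 'n"
      have "(\<forall>j<0. N (y (j - k)) \<le> 1) \<longleftrightarrow> (\<forall>j<(- k). N (y j) \<le> 1)"
        by (auto, metis add_diff_cancel_right' add.commute less_minus_iff minus_add_cancel neg_less_0_iff_less
            add_less_same_cancel1 less_diff_eq uminus_add_conv_diff diff_0)
      moreover have "(\<forall>j>k. N (y (j - k)) \<le> 1) \<longleftrightarrow> (\<forall>j>0. N (y j) \<le> 1)"
        by (auto, metis add_diff_cancel_right' less_add_same_cancel2)
      ultimately show "indicator (first_exceedance N 1 0 \<inter> last_exceedance N 1 k) (rescale 1 k y) *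
        indicator {y. 1 < N (y (- k))} y
        = (indicator (first_exceedance N 1 (- k) \<inter> last_exceedance N 1 0) y :: ennreal)"
        by (auto simp: indicator_def rescale_def first_exceedance_def last_exceedance_def)
    qed
    finally show ?thesis by simp
  qed
  have "(\<integral>\<^sup>+k. emeasure L (first_exceedance N 1 0 \<inter> last_exceedance N 1 k) \<partial>count_space UNIV)
     = (\<integral>\<^sup>+k. emeasure L (first_exceedance N 1 k \<inter> last_exceedance N 1 0) \<partial>count_space UNIV)"
    unfolding shift by (rule nn_integral_bij_count_space[OF bij_uminus])
  with A1 A2 show ?thesis by (simp add: measure_def)
qed

section \<open>Independence of radius and angle\<close>

text \<open>The angular part of a sequence; applied to $Y$ it gives the spectral tail process.\<close>

definition polar :: "(int \<Rightarrow> real ^ 'n) \<Rightarrow> (int \<Rightarrow> real ^ 'n)" where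
  "polar y = (\<lambda>k. (1 / N (y 0)) *\<^sub>R y k)"

lemma polar_measurable [measurable]: "polar \<in> borel_measurable borel"
  unfolding polar_def by (rule measurable_coordinatewise_then_product) measurable

definition radius_law :: "real measure" where
  "radius_law = distr L borel (\<lambda>y. N (y 0))"

lemma radius_law_sets [measurable_cong, simp]: "sets radius_law = sets borel"
  unfolding radius_law_def by simp

lemma prob_radius_law: "prob_space radius_law"
  unfolding radius_law_def by (rule prob_space_distr) measurable

lemma radius_law_tail:
  assumes "0 < x"
  shows "emeasure radius_law {x<..} = ennreal (min 1 (x powr (- \<alpha>)))"
proof (cases "x \<le> 1")
  case True
  have "emeasure radius_law {x<..} = emeasure L {y. x < N (y 0)}"
    unfolding radius_law_def by (subst emeasure_distr) (auto simp: vimage_def)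
  also have "\<dots> = emeasure L (space L)"
    using AE_radius True by (intro emeasure_eq_AE) (auto elim!: eventually_mono)
  also have "\<dots> = 1" by (rule emeasure_space_1)
  finally show ?thesis using True assms alpha_pos ge_one_powr_ge_zero[of "1 / x" \<alpha>]
    by (simp add: powr_minus powr_divide divide_simps min_def)
next
  case False
  then have "x powr (- \<alpha>) \<le> 1" using alpha_pos ge_one_powr_ge_zero[of x \<alpha>]
    by (simp add: powr_minus divide_simps)
  moreover have "emeasure radius_law {x<..} = emeasure L {y. x < N (y 0)}"
    unfolding radius_law_def by (subst emeasure_distr) (auto simp: vimage_def)
  ultimately show ?thesis using False radius[of x] by (simp add: emeasure_eq_measure)
qed

lemma polar_rescale: "0 < t \<Longrightarrow> polar (rescale t 0 y) = polar y"
  unfolding polar_def rescale_def by (auto simp: is_norm_scale[OF norm] fun_eq_iff)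

text \<open>The angle does not change under scaling, so the time change with $i = 0$ and $t = 1/x$ only
  touches the radius.\<close>

lemma radius_polar_independent:
  assumes [measurable]: "B \<in> sets borel" and x: "1 \<le> x"
  shows "emeasure L {y. x < N (y 0) \<and> polar y \<in> B} = ennreal (x powr (- \<alpha>)) * emeasure L {y. polar y \<in> B}"
proof -
  have "emeasure L {y. polar y \<in> B} = (\<integral>\<^sup>+y. indicator {y. polar y \<in> B} y \<partial>L)"
    by (rule nn_integral_indicator[symmetric]) measurable
  also have "\<dots> = (\<integral>\<^sup>+y. indicator {y. polar y \<in> B} y * indicator {y. 1 / x < N (y 0)} y \<partial>L)"
    using AE_radius
  proof (intro nn_integral_cong_AE, eventually_elim)
    case (elim y)
    have "1 / x \<le> 1" using x by simp
    with elim have "1 / x < N (y 0)" by linarith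
    then show ?case by (simp add: indicator_def)
  qed
  also have "\<dots> = ennreal ((1 / x) powr (- \<alpha>)) * (\<integral>\<^sup>+y. indicator {y. polar y \<in> B} (rescale (1 / x) 0 y) *
      indicator {y. 1 < 1 / x * N (y (- 0))} y \<partial>L)"
    using x by (intro time_change) auto
  also have "(\<integral>\<^sup>+y. indicator {y. polar y \<in> B} (rescale (1 / x) 0 y) *
      indicator {y. 1 < 1 / x * N (y (- 0))} y \<partial>L) = (\<integral>\<^sup>+y. indicator {y. x < N (y 0) \<and> polar y \<in> B} y \<partial>L)"
    using x by (intro nn_integral_cong) (auto simp: indicator_def polar_rescale)
  also have "\<dots> = emeasure L {y. x < N (y 0) \<and> polar y \<in> B}" by (rule nn_integral_indicator) measurable
  finally show ?thesis using x
    by (simp add: ennreal_mult[symmetric] powr_divide powr_minus mult.assoc[symmetric])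
qed


text \<open>For a fixed event on the angle, two finite measures of the radius are compared on the half-lines,
  which form a generator stable under intersection.\<close>

lemma radius_polar_product:
  "distr L (borel \<Otimes>\<^sub>M borel) (\<lambda>y. (N (y 0), polar y)) = radius_law \<Otimes>\<^sub>M distr L borel polar"
proof (rule pair_measure_eqI[symmetric])
  interpret R: prob_space radius_law by (rule prob_radius_law)
  interpret A: prob_space "distr L borel polar" by (rule prob_space_distr) measurable
  show "sigma_finite_measure radius_law" "sigma_finite_measure (distr L borel polar)" by unfold_locales
  show "sets (radius_law \<Otimes>\<^sub>M distr L borel polar) = sets (distr L (borel \<Otimes>\<^sub>M borel) (\<lambda>y. (N (y 0), polar y)))"
    by (simp cong: sets_pair_measure_cong)
  fix A B assume A: "A \<in> sets radius_law" and "B \<in> sets (distr L borel polar)"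
  then have B[measurable]: "B \<in> sets borel" by simp
  define c where "c = emeasure L {y. polar y \<in> B}"
  define \<mu> where "\<mu> = distr (density L (indicator {y. polar y \<in> B})) borel (\<lambda>y. N (y 0))"
  define \<nu> where "\<nu> = scale_measure c radius_law"
  have \<mu>: "emeasure \<mu> D = emeasure L {y. N (y 0) \<in> D \<and> polar y \<in> B}" if [measurable]: "D \<in> sets borel" for D
  proof -
    have "emeasure \<mu> D = emeasure (density L (indicator {y. polar y \<in> B})) {y. N (y 0) \<in> D}"
      unfolding \<mu>_def by (subst emeasure_distr) (auto simp: vimage_def)
    also have "\<dots> = (\<integral>\<^sup>+y. indicator {y. polar y \<in> B} y * indicator {y. N (y 0) \<in> D} y \<partial>L)"
      by (rule emeasure_density) measurable
    also have "\<dots> = (\<integral>\<^sup>+y. indicator {y. N (y 0) \<in> D \<and> polar y \<in> B} y \<partial>L)"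
      by (intro nn_integral_cong) (auto simp: indicator_def)
    finally show ?thesis by simp
  qed
  have "\<mu> = \<nu>"
  proof (rule measure_eqI_generator_eq[where \<Omega> = UNIV and E = "range greaterThan" and A = "\<lambda>i. {- real i<..}"])
    show "Int_stable (range greaterThan :: real set set)"
    proof (rule Int_stableI)
      fix a b :: "real set" assume "a \<in> range greaterThan" "b \<in> range greaterThan"
      then obtain x y where "a = {x<..}" "b = {y<..}" by auto
      then have "a \<inter> b = {max x y<..}" by auto
      then show "a \<inter> b \<in> range greaterThan" by blast
    qed
    show "sets \<mu> = sigma_sets UNIV (range greaterThan)" "sets \<nu> = sigma_sets UNIV (range greaterThan)"
      unfolding \<mu>_def \<nu>_def by (simp_all add: borel_Ioi)
    fix S :: "real set" assume "S \<in> range greaterThan"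
    then obtain x where S: "S = {x<..}" by auto
    have tail1: "emeasure L {y. x < N (y 0) \<and> polar y \<in> B} = c" if "x \<le> 1"
      unfolding c_def using AE_radius that by (intro emeasure_eq_AE) (auto elim!: eventually_mono)
    have tail2: "emeasure radius_law {x<..} = 1" if "x \<le> 1"
    proof -
      have "emeasure radius_law {x<..} = emeasure L {y. x < N (y 0)}"
        unfolding radius_law_def by (subst emeasure_distr) (auto simp: vimage_def)
      also have "\<dots> = emeasure L (space L)"
        using AE_radius that by (intro emeasure_eq_AE) (auto elim!: eventually_mono)
      finally show ?thesis by (simp only: emeasure_space_1)
    qed
    have tail3: "emeasure radius_law {x<..} = ennreal (x powr (- \<alpha>))" if "\<not> x \<le> 1"
      using that alpha_pos ge_one_powr_ge_zero[of x \<alpha>]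
      by (subst radius_law_tail) (auto simp: powr_minus divide_simps min_def)
    show "emeasure \<mu> S = emeasure \<nu> S"
    proof (cases "x \<le> 1")
      case True
      then show ?thesis unfolding S \<nu>_def by (simp add: \<mu> tail1 tail2)
    next
      case False
      then show ?thesis unfolding S \<nu>_def
        by (simp add: \<mu> tail3 radius_polar_independent c_def mult.commute)
    qed
  next
    show "(\<Union>i. {- real i<..}) = UNIV"
      by (auto simp: minus_less_iff intro: reals_Archimedean2)
    show "emeasure \<mu> {- real i<..} \<noteq> \<infinity>" for i by (simp add: \<mu>)
  qed auto
  have "emeasure radius_law A * emeasure (distr L borel polar) B = emeasure \<nu> A"
    using A unfolding \<nu>_def c_def
    by (subst emeasure_distr) (auto simp: vimage_def mult.commute)
  also have "\<dots> = emeasure L {y. N (y 0) \<in> A \<and> polar y \<in> B}"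
    using A unfolding \<open>\<mu> = \<nu>\<close>[symmetric] by (intro \<mu>) simp
  also have "\<dots> = emeasure (distr L (borel \<Otimes>\<^sub>M borel) (\<lambda>y. (N (y 0), polar y))) (A \<times> B)"
    using A by (subst emeasure_distr) (auto simp: vimage_def)
  finally show "emeasure radius_law A * emeasure (distr L borel polar) B
    = emeasure (distr L (borel \<Otimes>\<^sub>M borel) (\<lambda>y. (N (y 0), polar y))) (A \<times> B)" .
qed

lemma nn_integral_polar:
  assumes F[measurable]: "case_prod F \<in> borel_measurable (borel \<Otimes>\<^sub>M borel)"
  shows "(\<integral>\<^sup>+y. F (N (y 0)) (polar y) \<partial>L) = (\<integral>\<^sup>+y. (\<integral>\<^sup>+r. F r (polar y) \<partial>radius_law) \<partial>L)"
proof -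
  interpret R: prob_space radius_law by (rule prob_radius_law)
  interpret A: prob_space "distr L borel polar" by (rule prob_space_distr) measurable
  interpret pair_sigma_finite radius_law "distr L borel polar" ..
  have "(\<integral>\<^sup>+y. F (N (y 0)) (polar y) \<partial>L) = (\<integral>\<^sup>+z. case_prod F z \<partial>distr L (borel \<Otimes>\<^sub>M borel) (\<lambda>y. (N (y 0), polar y)))"
    by (subst nn_integral_distr) auto
  also have "\<dots> = (\<integral>\<^sup>+\<theta>. (\<integral>\<^sup>+r. F r \<theta> \<partial>radius_law) \<partial>distr L borel polar)"
    unfolding radius_polar_product by (subst nn_integral_snd[symmetric]) auto
  also have "\<dots> = (\<integral>\<^sup>+y. (\<integral>\<^sup>+r. F r (polar y) \<partial>radius_law) \<partial>L)"
    by (subst nn_integral_distr) auto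
  finally show ?thesis .
qed

end

section \<open>The cluster formula\<close>

lemma borel_measurable_nn_integral_countable:
  fixes f :: "'i::countable \<Rightarrow> 'a \<Rightarrow> ennreal"
  assumes [measurable]: "\<And>j. f j \<in> borel_measurable M"
  shows "(\<lambda>x. \<integral>\<^sup>+j. f j x \<partial>count_space UNIV) \<in> borel_measurable M"
proof -
  interpret sigma_finite_measure "count_space (UNIV :: 'i set)"
    by (rule sigma_finite_measure_count_space)
  have "(\<lambda>z. f (snd z) (fst z)) \<in> borel_measurable (M \<Otimes>\<^sub>M count_space UNIV)"
    by (rule measurable_compose_countable) measurable
  then show ?thesis by (intro borel_measurable_nn_integral) (simp add: case_prod_beta')
qed

lemma sup_norm_measurable [measurable]:
  assumes "is_norm N"
  shows "sup_norm N J \<in> borel_measurable borel"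
proof -
  have [measurable]: "N \<in> borel_measurable borel" by (rule is_norm_measurable[OF assms])
  show ?thesis unfolding sup_norm_def[abs_def] by (intro borel_measurable_SUP) auto
qed

context tail_law
begin

text \<open>$y^*$ as a real number; a sequence with infinite supremum gets the value $0$.\<close>

definition peak :: "(int \<Rightarrow> real ^ 'n) \<Rightarrow> real" where
  "peak y = enn2real (sup_norm N UNIV y)"

lemma peak_measurable [measurable]: "peak \<in> borel_measurable borel"
  unfolding peak_def[abs_def] using sup_norm_measurable[OF norm] by measurable

lemma peak_nonneg: "0 \<le> peak y" unfolding peak_def by simp

lemma peak_rescale: assumes "0 < t" shows "peak (rescale t i y) = t * peak y"
proof -
  have "sup_norm N UNIV (rescale t i y) = (SUP k. ennreal t * ennreal (N (y (k - i))))"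
    unfolding sup_norm_def rescale_def using assms
    by (simp add: is_norm_scale[OF norm] ennreal_mult is_norm_nonneg[OF norm])
  also have "\<dots> = ennreal t * (SUP k. ennreal (N (y (k - i))))"
    by (rule SUP_mult_left_ennreal[symmetric])
  also have "(SUP k. ennreal (N (y (k - i)))) = (SUP k\<in>(\<lambda>k. k - i) ` UNIV. ennreal (N (y k)))"
    by (simp only: image_image)
  also have "(\<lambda>k. k - i) ` UNIV = UNIV" by (rule surj_diff_right)
  finally show ?thesis using assms unfolding peak_def sup_norm_def[symmetric]
    by (simp add: enn2real_mult)
qed

lemma AE_sup_norm_finite: "AE y in L. sup_norm N UNIV y < \<infinity>"
  using AE_finite_exceeds
proof eventually_elim
  case (elim y)
  then have fin: "finite (exceeds N 1 y)" by auto
  have "N (y k) \<le> 1 + (\<Sum>i\<in>exceeds N 1 y. N (y i))" for k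
  proof (cases "k \<in> exceeds N 1 y")
    case True
    then have "N (y k) \<le> (\<Sum>i\<in>exceeds N 1 y. N (y i))"
      using fin by (intro member_le_sum) (auto simp: is_norm_nonneg[OF norm])
    then show ?thesis by simp
  next
    case False
    then show ?thesis by (auto simp: exceeds_def intro!: add_increasing2 sum_nonneg is_norm_nonneg[OF norm])
  qed
  then have "sup_norm N UNIV y \<le> ennreal (1 + (\<Sum>i\<in>exceeds N 1 y. N (y i)))"
    unfolding sup_norm_def by (intro SUP_least ennreal_leI) auto
  then show ?case by (rule order.strict_trans1) simp
qed

lemma le_peak: assumes "sup_norm N UNIV y < \<infinity>" shows "N (y k) \<le> peak y"
proof -
  have "ennreal (N (y k)) \<le> sup_norm N UNIV y" unfolding sup_norm_def by (rule SUP_upper) simp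
  also have "\<dots> = ennreal (peak y)" unfolding peak_def using assms by simp
  finally show ?thesis by (simp add: peak_nonneg)
qed

lemma exceeds_iff_peak:
  assumes "sup_norm N UNIV y < \<infinity>" "0 < t"
  shows "exceeds N t y \<noteq> {} \<longleftrightarrow> 1 < t * peak y"
proof -
  have "1 < t * peak y \<longleftrightarrow> ennreal (1 / t) < ennreal (peak y)"
    using assms(2) by (simp add: ennreal_less_iff divide_less_eq mult.commute)
  also have "ennreal (peak y) = sup_norm N UNIV y" unfolding peak_def using assms(1) by simp
  also have "ennreal (1 / t) < sup_norm N UNIV y \<longleftrightarrow> (\<exists>k. 1 / t < N (y k))"
    unfolding sup_norm_def using assms(2) by (simp add: less_SUP_iff ennreal_less_iff)
  also have "\<dots> \<longleftrightarrow> exceeds N t y \<noteq> {}"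
    using assms(2) by (auto simp: exceeds_def divide_less_eq mult.commute)
  finally show ?thesis by simp
qed

lemma first_exceedance_rescale:
  assumes "0 < t"
  shows "rescale t j y \<in> first_exceedance N 1 0 \<longleftrightarrow> y \<in> first_exceedance N t (- j)"
proof -
  have "(\<forall>k<0. t * N (y (k - j)) \<le> 1) \<longleftrightarrow> (\<forall>k<(- j). t * N (y k) \<le> 1)"
  proof safe
    fix k assume *: "\<forall>k<0. t * N (y (k - j)) \<le> 1" "k < - j"
    then have "k + j < 0" by simp
    with *(1) have "t * N (y (k + j - j)) \<le> 1" by blast
    then show "t * N (y k) \<le> 1" by simp
  qed auto
  then show ?thesis using assms
    by (auto simp: first_exceedance_def rescale_def is_norm_scale[OF norm])
qed

lemma polar_eq_rescale: "polar y = rescale (1 / N (y 0)) 0 y"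
  unfolding polar_def rescale_def by simp

context
  fixes G :: "(int \<Rightarrow> real ^ 'n) \<Rightarrow> ennreal"
  assumes G[measurable]: "G \<in> borel_measurable borel"
    and G_hom: "\<And>c y. 0 < c \<Longrightarrow> G (\<lambda>k. c *\<^sub>R y k) = ennreal (c powr \<alpha>) * G y"
begin

text \<open>For $\alpha$-homogeneous $G$ this is the $0$-homogeneous function $G(y)/(y^*)^\alpha$, a function of
  the angle alone.\<close>

definition peak_normalized :: "(int \<Rightarrow> real ^ 'n) \<Rightarrow> ennreal" where
  "peak_normalized y = G y * ennreal (peak y powr (- \<alpha>))"

lemma peak_normalized_measurable [measurable]: "peak_normalized \<in> borel_measurable borel"
  unfolding peak_normalized_def[abs_def] by measurable

lemma powr_cancel: "0 < t \<Longrightarrow> ennreal (t powr \<alpha>) * ennreal (t powr (- \<alpha>)) = 1"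
  by (simp add: ennreal_mult[symmetric] powr_add[symmetric])

lemma peak_normalized_hom: assumes "0 < t" shows "peak_normalized (\<lambda>k. t *\<^sub>R y k) = peak_normalized y"
proof -
  have "peak (\<lambda>k. t *\<^sub>R y k) = t * peak y"
    using peak_rescale[OF assms, of 0 y] by (simp add: rescale_def)
  then have "peak_normalized (\<lambda>k. t *\<^sub>R y k) = ennreal (t powr \<alpha>) * G y * ennreal ((t * peak y) powr (- \<alpha>))"
    unfolding peak_normalized_def G_hom[OF assms] by simp
  also have "\<dots> = (ennreal (t powr \<alpha>) * ennreal (t powr (- \<alpha>))) * peak_normalized y"
    unfolding peak_normalized_def using assms by (simp add: powr_mult peak_nonneg ennreal_mult mult_ac)
  finally show ?thesis by (simp add: powr_cancel[OF assms])
qed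

text \<open>The cluster formula restricted to coordinates $j$ with $|y_j| > t$. The time change turns the
  $j$-th summand into an integral over the event that the level $1/t$ is first exceeded at $-j$.
  Summation over $j$ leaves the event $\{t y^* > 1\}$; given the angle, this is an event about the
  radius, whose probability is $\min(1, (t\theta^*)^\alpha)$.\<close>

lemma cluster_formula_level:
  assumes t: "0 < t" "t \<le> 1"
  shows "(\<integral>\<^sup>+j. (\<integral>\<^sup>+y. indicator (first_exceedance N 1 0) y * ennreal (peak y powr (- \<alpha>)) *
            G (rescale 1 (- j) y) * indicator {y. t < N (y j)} y \<partial>L) \<partial>count_space UNIV)
    = (\<integral>\<^sup>+y. peak_normalized (polar y) * ennreal (min (t powr (- \<alpha>)) (peak (polar y) powr \<alpha>)) \<partial>L)"
proof -
  let ?c = "ennreal (t powr (- \<alpha>))"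
  have step1: "(\<integral>\<^sup>+y. indicator (first_exceedance N 1 0) y * ennreal (peak y powr (- \<alpha>)) *
            G (rescale 1 (- j) y) * indicator {y. t < N (y j)} y \<partial>L)
      = ?c * (\<integral>\<^sup>+y. indicator (first_exceedance N t (- j)) y * peak_normalized y \<partial>L)" for j
  proof -
    have shift: "rescale 1 (- j) (rescale t j y) = (\<lambda>k. t *\<^sub>R y k)" for y :: "int \<Rightarrow> real ^ 'n"
      unfolding rescale_def by simp
    have "(\<integral>\<^sup>+y. indicator (first_exceedance N 1 0) y * ennreal (peak y powr (- \<alpha>)) *
            G (rescale 1 (- j) y) * indicator {y. t < N (y j)} y \<partial>L)
      = ?c * (\<integral>\<^sup>+y. indicator (first_exceedance N 1 0) (rescale t j y) *
           ennreal (peak (rescale t j y) powr (- \<alpha>)) *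
            G (rescale 1 (- j) (rescale t j y)) * indicator {y. 1 < t * N (y (- j))} y \<partial>L)"
      by (rule time_change[OF t]) measurable
    also have "(\<integral>\<^sup>+y. indicator (first_exceedance N 1 0) (rescale t j y) *
           ennreal (peak (rescale t j y) powr (- \<alpha>)) *
            G (rescale 1 (- j) (rescale t j y)) * indicator {y. 1 < t * N (y (- j))} y \<partial>L)
      = (\<integral>\<^sup>+y. indicator (first_exceedance N t (- j)) y * peak_normalized y \<partial>L)"
    proof (intro nn_integral_cong)
      fix y :: "int \<Rightarrow> real ^ 'n"
      have 1: "ennreal (peak (rescale t j y) powr (- \<alpha>)) * G (rescale 1 (- j) (rescale t j y)) = peak_normalized y"
        using peak_normalized_hom[OF t(1), of y] peak_rescale[OF t(1), of 0 y] peak_rescale[OF t(1), of j y]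
        unfolding peak_normalized_def shift by (simp add: rescale_def mult.commute)
      have 2: "indicator (first_exceedance N 1 0) (rescale t j y) * indicator {y. 1 < t * N (y (- j))} y
          = (indicator (first_exceedance N t (- j)) y :: ennreal)"
        using first_exceedance_rescale[OF t(1), of j y]
        by (auto simp: indicator_def first_exceedance_def[of N t])
      show "indicator (first_exceedance N 1 0) (rescale t j y) *
           ennreal (peak (rescale t j y) powr (- \<alpha>)) *
            G (rescale 1 (- j) (rescale t j y)) * indicator {y. 1 < t * N (y (- j))} y
          = indicator (first_exceedance N t (- j)) y * peak_normalized y"
        unfolding 1[symmetric] 2[symmetric] by (simp add: mult_ac)
    qed
    finally show ?thesis .
  qed
  have "(\<integral>\<^sup>+j. (\<integral>\<^sup>+y. indicator (first_exceedance N 1 0) y * ennreal (peak y powr (- \<alpha>)) *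
            G (rescale 1 (- j) y) * indicator {y. t < N (y j)} y \<partial>L) \<partial>count_space UNIV)
     = ?c * (\<integral>\<^sup>+j. (\<integral>\<^sup>+y. indicator (first_exceedance N t (- j)) y * peak_normalized y \<partial>L) \<partial>count_space UNIV)"
    unfolding step1 by (rule nn_integral_cmult) simp
  also have "(\<integral>\<^sup>+j. (\<integral>\<^sup>+y. indicator (first_exceedance N t (- j)) y * peak_normalized y \<partial>L) \<partial>count_space UNIV)
      = (\<integral>\<^sup>+j. (\<integral>\<^sup>+y. indicator (first_exceedance N t j) y * peak_normalized y \<partial>L) \<partial>count_space UNIV)"
    by (rule nn_integral_bij_count_space[OF bij_uminus])
  also have "\<dots> = (\<integral>\<^sup>+y. (\<integral>\<^sup>+j. indicator (first_exceedance N t j) y * peak_normalized y \<partial>count_space UNIV) \<partial>L)"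
    by (rule nn_integral_count_space_nn_integral[symmetric]) auto
  also have "\<dots> = (\<integral>\<^sup>+y. peak_normalized (polar y) * indicator {r. 1 < t * r * peak (polar y)} (N (y 0)) \<partial>L)"
    using AE_radius AE_finite_exceeds AE_sup_norm_finite
  proof (intro nn_integral_cong_AE, eventually_elim)
    case (elim y)
    have "(\<integral>\<^sup>+j. indicator (first_exceedance N t j) y * peak_normalized y \<partial>count_space UNIV)
        = indicator {y. exceeds N t y \<noteq> {}} y * peak_normalized y"
      using elim t by (subst nn_integral_multc) (auto simp: sum_first_exceedance)
    moreover have "peak_normalized (polar y) = peak_normalized y"
      unfolding polar_def using elim by (intro peak_normalized_hom) simp
    moreover have "N (y 0) * peak (polar y) = peak y"
      unfolding polar_eq_rescale using elim by (subst peak_rescale) auto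
    ultimately show ?case
      using exceeds_iff_peak[of y t] elim t by (simp add: indicator_def mult.assoc)
  qed
  also have "\<dots> = (\<integral>\<^sup>+y. (\<integral>\<^sup>+r. peak_normalized (polar y) * indicator {r. 1 < t * r * peak (polar y)} r \<partial>radius_law) \<partial>L)"
    by (rule nn_integral_polar) measurable
  also have "\<dots> = (\<integral>\<^sup>+y. peak_normalized (polar y) * ennreal (min 1 ((t * peak (polar y)) powr \<alpha>)) \<partial>L)"
    using AE_radius AE_sup_norm_finite
  proof (intro nn_integral_cong_AE, eventually_elim)
    case (elim y)
    have "peak y > 0" using elim le_peak[of y 0] by linarith
    then have p: "peak (polar y) > 0"
      unfolding polar_eq_rescale using elim by (subst peak_rescale) auto
    have "{r. 1 < t * r * peak (polar y)} = {1 / (t * peak (polar y))<..}"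
      using t p by (auto simp: divide_less_eq mult_ac)
    then have "emeasure radius_law {r. 1 < t * r * peak (polar y)} = ennreal (min 1 ((t * peak (polar y)) powr \<alpha>))"
      using t p by (simp add: radius_law_tail powr_minus powr_divide inverse_eq_divide)
    moreover have "(\<integral>\<^sup>+r. peak_normalized (polar y) * indicator {r. 1 < t * r * peak (polar y)} r \<partial>radius_law)
       = peak_normalized (polar y) * emeasure radius_law {r. 1 < t * r * peak (polar y)}"
      by (rule nn_integral_cmult_indicator) simp
    ultimately show ?case by simp
  qed
  also have "?c * \<dots> = (\<integral>\<^sup>+y. ?c * (peak_normalized (polar y) * ennreal (min 1 ((t * peak (polar y)) powr \<alpha>))) \<partial>L)"
    by (rule nn_integral_cmult[symmetric]) measurable
  also have "\<dots> = (\<integral>\<^sup>+y. peak_normalized (polar y) * ennreal (min (t powr (- \<alpha>)) (peak (polar y) powr \<alpha>)) \<partial>L)"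
  proof (intro nn_integral_cong)
    fix y
    have "t powr (- \<alpha>) * min 1 ((t * peak (polar y)) powr \<alpha>)
        = min (t powr (- \<alpha>)) (t powr (- \<alpha>) * (t powr \<alpha> * peak (polar y) powr \<alpha>))"
      using t by (simp add: min_mult_distrib_left powr_mult peak_nonneg)
    also have "t powr (- \<alpha>) * (t powr \<alpha> * peak (polar y) powr \<alpha>) = peak (polar y) powr \<alpha>"
      using t by (simp add: mult.assoc[symmetric] powr_add[symmetric])
    finally have *: "t powr (- \<alpha>) * min 1 ((t * peak (polar y)) powr \<alpha>) = min (t powr (- \<alpha>)) (peak (polar y) powr \<alpha>)" .
    have "?c * (peak_normalized (polar y) * ennreal (min 1 ((t * peak (polar y)) powr \<alpha>)))
        = peak_normalized (polar y) * ennreal (t powr (- \<alpha>) * min 1 ((t * peak (polar y)) powr \<alpha>))"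
      by (simp add: ennreal_mult mult_ac)
    then show "?c * (peak_normalized (polar y) * ennreal (min 1 ((t * peak (polar y)) powr \<alpha>)))
        = peak_normalized (polar y) * ennreal (min (t powr (- \<alpha>)) (peak (polar y) powr \<alpha>))" unfolding * .
  qed
  finally show ?thesis .
qed

text \<open>Monotone limit $t = 1/(n+1) \downarrow 0$ on both sides of \<open>cluster_formula_level\<close>.\<close>

lemma cluster_formula_anchored:
  "(\<integral>\<^sup>+y. G (polar y) \<partial>L) = (\<integral>\<^sup>+y. indicator (first_exceedance N 1 0) y * ennreal (peak y powr (- \<alpha>)) *
     (\<integral>\<^sup>+j. G (rescale 1 (- j) y) * indicator {j. y j \<noteq> 0} j \<partial>count_space UNIV) \<partial>L)"
proof -
  define t :: "nat \<Rightarrow> real" where "t n = 1 / Suc n" for n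
  have t: "0 < t n" "t n \<le> 1" for n by (auto simp: t_def)
  have t_mono: "t n \<le> t m" if "m \<le> n" for m n using that by (auto simp: t_def divide_simps)
  have t_lim: "eventually (\<lambda>n. t n < e) sequentially" if "e > 0" for e
    using LIMSEQ_inverse_real_of_nat that unfolding t_def
    by (intro order_tendstoD) (auto simp: inverse_eq_divide)
  let ?h = "\<lambda>y. indicator (first_exceedance N 1 0) y * ennreal (peak y powr (- \<alpha>))"
  let ?f = "\<lambda>n y. \<integral>\<^sup>+j. ?h y * G (rescale 1 (- j) y) * indicator {y. t n < N (y j)} y \<partial>count_space UNIV"
  let ?r = "\<lambda>n y. peak_normalized (polar y) * ennreal (min (t n powr (- \<alpha>)) (peak (polar y) powr \<alpha>))"
  have level: "(\<integral>\<^sup>+y. ?f n y \<partial>L) = (\<integral>\<^sup>+y. ?r n y \<partial>L)" for n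
    by (subst cluster_formula_level[OF t, symmetric], rule nn_integral_count_space_nn_integral) auto
  have lim_f: "(\<lambda>n. ?f n y) \<longlonglongrightarrow> (\<integral>\<^sup>+j. ?h y * G (rescale 1 (- j) y) * indicator {j. y j \<noteq> 0} j \<partial>count_space UNIV)" for y
  proof (rule nn_integral_LIMSEQ)
    show "incseq (\<lambda>n j. ?h y * G (rescale 1 (- j) y) * indicator {y. t n < N (y j)} y)"
      by (intro incseq_SucI le_funI mult_left_mono)
        (auto simp: indicator_def dest: less_le_trans[rotated] intro: order.strict_trans1[OF t_mono[OF le_SucI[OF order_refl]]])
    fix j
    have "eventually (\<lambda>n. indicator {y. t n < N (y j)} y = (indicator {j. y j \<noteq> 0} j :: ennreal)) sequentially"
    proof (cases "y j = 0")
      case True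
      then have "N (y j) = 0" using is_norm_zero[OF norm] by simp
      then have "\<not> t n < N (y j)" for n using t(1)[of n] by simp
      with True show ?thesis by (simp add: indicator_def)
    next
      case False
      then have "N (y j) > 0" using is_norm_zero[OF norm, of "y j"] is_norm_nonneg[OF norm, of "y j"] by simp
      then have "eventually (\<lambda>n. t n < N (y j)) sequentially" by (rule t_lim)
      then show ?thesis using False by (auto elim!: eventually_mono simp: indicator_def)
    qed
    then show "(\<lambda>n. ?h y * G (rescale 1 (- j) y) * indicator {y. t n < N (y j)} y)
       \<longlonglongrightarrow> ?h y * G (rescale 1 (- j) y) * indicator {j. y j \<noteq> 0} j"
      by (intro tendsto_eventually) (auto elim!: eventually_mono)
  qed simp
  have inc_f: "incseq ?f"
    by (intro incseq_SucI le_funI nn_integral_mono mult_left_mono)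
      (auto simp: indicator_def intro: order.strict_trans1[OF t_mono[OF le_SucI[OF order_refl]]])
  have meas_f: "?f n \<in> borel_measurable L" for n
    by (rule borel_measurable_nn_integral_countable) measurable
  have "(\<lambda>n. \<integral>\<^sup>+y. ?f n y \<partial>L) \<longlonglongrightarrow>
      (\<integral>\<^sup>+y. (\<integral>\<^sup>+j. ?h y * G (rescale 1 (- j) y) * indicator {j. y j \<noteq> 0} j \<partial>count_space UNIV) \<partial>L)"
    by (rule nn_integral_LIMSEQ[OF inc_f meas_f lim_f])
  moreover have "(\<lambda>n. \<integral>\<^sup>+y. ?r n y \<partial>L) \<longlonglongrightarrow> (\<integral>\<^sup>+y. peak_normalized (polar y) * ennreal (peak (polar y) powr \<alpha>) \<partial>L)"
  proof (rule nn_integral_LIMSEQ)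
    show "incseq ?r"
    proof (intro incseq_SucI le_funI mult_left_mono ennreal_leI min.mono order_refl)
      fix n show "t n powr (- \<alpha>) \<le> t (Suc n) powr (- \<alpha>)"
        using t t_mono[of n "Suc n"] alpha_pos by (intro powr_mono2') auto
    qed auto
    fix y
    have "filterlim (\<lambda>n. t n powr (- \<alpha>)) at_top sequentially"
      unfolding t_def using alpha_pos by real_asymp
    then have "eventually (\<lambda>n. peak (polar y) powr \<alpha> \<le> t n powr (- \<alpha>)) sequentially"
      by (simp add: filterlim_at_top)
    then show "(\<lambda>n. ?r n y) \<longlonglongrightarrow> peak_normalized (polar y) * ennreal (peak (polar y) powr \<alpha>)"
      by (intro tendsto_eventually) (auto elim!: eventually_mono simp: min_def)
  qed measurable
  ultimately have "(\<integral>\<^sup>+y. peak_normalized (polar y) * ennreal (peak (polar y) powr \<alpha>) \<partial>L)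
      = (\<integral>\<^sup>+y. (\<integral>\<^sup>+j. ?h y * G (rescale 1 (- j) y) * indicator {j. y j \<noteq> 0} j \<partial>count_space UNIV) \<partial>L)"
    unfolding level by (rule LIMSEQ_unique[rotated])
  also have "\<dots> = (\<integral>\<^sup>+y. ?h y * (\<integral>\<^sup>+j. G (rescale 1 (- j) y) * indicator {j. y j \<noteq> 0} j \<partial>count_space UNIV) \<partial>L)"
    by (intro nn_integral_cong) (simp add: nn_integral_cmult[symmetric] mult.assoc)
  also have "(\<integral>\<^sup>+y. peak_normalized (polar y) * ennreal (peak (polar y) powr \<alpha>) \<partial>L) = (\<integral>\<^sup>+y. G (polar y) \<partial>L)"
    using AE_radius AE_sup_norm_finite
  proof (intro nn_integral_cong_AE, eventually_elim)
    case (elim y)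
    have "peak y > 0" using elim le_peak[of y 0] by linarith
    then have p: "peak (polar y) > 0"
      unfolding polar_eq_rescale using elim by (subst peak_rescale) auto
    have "ennreal (peak (polar y) powr (- \<alpha>)) * ennreal (peak (polar y) powr \<alpha>) = 1"
      using powr_cancel[OF p] by (simp only: mult.commute)
    then show ?case unfolding peak_normalized_def by (simp only: mult.assoc mult_1_right)
  qed
  finally show ?thesis .
qed

end

text \<open>The probability of the conditioning event in the definition of $Q$, so the event of no exceedance
  in the past.\<close>

definition extremal_index :: real where
  "extremal_index = measure L {y. sup_norm N {..-1} y \<le> 1}"

definition normalize_peak :: "(int \<Rightarrow> real ^ 'n) \<Rightarrow> (int \<Rightarrow> real ^ 'n)" where
  "normalize_peak y = (\<lambda>k. inverse (peak y) *\<^sub>R y k)"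

lemma normalize_peak_measurable [measurable]: "normalize_peak \<in> borel_measurable borel"
  unfolding normalize_peak_def by (rule measurable_coordinatewise_then_product) measurable

definition cluster_law :: "(int \<Rightarrow> real ^ 'n) measure" where
  "cluster_law = distr (uniform_measure L {y. sup_norm N {..-1} y \<le> 1}) borel normalize_peak"

lemma cluster_law_sets [measurable_cong, simp]: "sets cluster_law = sets borel"
  unfolding cluster_law_def by simp

lemma nn_integral_cluster_law:
  assumes [measurable]: "F \<in> borel_measurable borel" and pos: "extremal_index > 0"
  shows "ennreal extremal_index * (\<integral>\<^sup>+q. F q \<partial>cluster_law) =
    (\<integral>\<^sup>+y. F (normalize_peak y) * indicator (first_exceedance N 1 0) y \<partial>L)"
proof -
  let ?A = "{y. sup_norm N {..-1} y \<le> 1}"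
  have [measurable]: "?A \<in> sets borel" using sup_norm_measurable[OF norm] by measurable
  have A: "emeasure L ?A = ennreal extremal_index"
    unfolding extremal_index_def by (rule emeasure_eq_measure)
  have "(\<integral>\<^sup>+q. F q \<partial>cluster_law) = (\<integral>\<^sup>+y. F (normalize_peak y) \<partial>uniform_measure L ?A)"
    unfolding cluster_law_def by (subst nn_integral_distr) auto
  also have "\<dots> = (\<integral>\<^sup>+y. F (normalize_peak y) * indicator ?A y \<partial>L) / ennreal extremal_index"
    using A by (subst nn_integral_uniform_measure) auto
  also have "(\<integral>\<^sup>+y. F (normalize_peak y) * indicator ?A y \<partial>L)
      = (\<integral>\<^sup>+y. F (normalize_peak y) * indicator (first_exceedance N 1 0) y \<partial>L)"
    using AE_radius
  proof (intro nn_integral_cong_AE, eventually_elim)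
    case (elim y)
    then have "y \<in> ?A \<longleftrightarrow> y \<in> first_exceedance N 1 0"
      by (auto simp: sup_norm_le_1 first_exceedance_def)
    then show ?case by (simp add: indicator_def)
  qed
  finally show ?thesis using pos
    by (simp add: ennreal_times_divide ennreal_mult_divide_eq mult.commute[of "ennreal extremal_index"])
qed

text \<open>Conditionally on no exceedance before $0$ the origin is the first exceedance, and
  $G(B^{-j} Q) = (Y^*)^{-\alpha} G(B^{-j} Y)$ by homogeneity.\<close>

theorem cluster_formula:
  assumes pos: "extremal_index > 0"
    and G[measurable]: "G \<in> borel_measurable borel"
    and G_hom: "\<And>c y. 0 < c \<Longrightarrow> G (\<lambda>k. c *\<^sub>R y k) = ennreal (c powr \<alpha>) * G y"
  shows "ennreal extremal_index *
      (\<integral>\<^sup>+q. (\<integral>\<^sup>+j. G (rescale 1 (- j) q) * indicator {j. q j \<noteq> 0} j \<partial>count_space UNIV) \<partial>cluster_law)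
    = (\<integral>\<^sup>+y. G (polar y) \<partial>L)"
proof -
  let ?S = "\<lambda>q. \<integral>\<^sup>+j. G (rescale 1 (- j) q) * indicator {j. q j \<noteq> 0} j \<partial>count_space UNIV"
  have [measurable]: "?S \<in> borel_measurable borel"
  proof (rule borel_measurable_nn_integral_countable)
    fix j :: int
    have "(\<lambda>q. G (rescale 1 (- j) q) * indicator {q. q j \<noteq> 0} q) \<in> borel_measurable borel" by measurable
    then show "(\<lambda>q. G (rescale 1 (- j) q) * indicator {j. q j \<noteq> 0} j) \<in> borel_measurable borel"
      by (simp add: indicator_def)
  qed
  have "ennreal extremal_index * (\<integral>\<^sup>+q. ?S q \<partial>cluster_law)
     = (\<integral>\<^sup>+y. ?S (normalize_peak y) * indicator (first_exceedance N 1 0) y \<partial>L)"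
    by (rule nn_integral_cluster_law[OF _ pos]) measurable
  also have "\<dots> = (\<integral>\<^sup>+y. indicator (first_exceedance N 1 0) y * ennreal (peak y powr (- \<alpha>)) * ?S y \<partial>L)"
    using AE_radius AE_sup_norm_finite
  proof (intro nn_integral_cong_AE, eventually_elim)
    case (elim y)
    have p: "peak y > 0" using elim le_peak[of y 0] by linarith
    have "G (rescale 1 (- j) (normalize_peak y)) = ennreal (peak y powr (- \<alpha>)) * G (rescale 1 (- j) y)" for j
    proof -
      have "rescale 1 (- j) (normalize_peak y) = (\<lambda>k. inverse (peak y) *\<^sub>R rescale 1 (- j) y k)"
        unfolding rescale_def normalize_peak_def by simp
      then show ?thesis using p by (simp add: G_hom inverse_powr powr_minus)
    qed
    then have "?S (normalize_peak y) = (\<integral>\<^sup>+j. ennreal (peak y powr (- \<alpha>)) *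
        (G (rescale 1 (- j) y) * indicator {j. y j \<noteq> 0} j) \<partial>count_space UNIV)"
      using p by (simp add: normalize_peak_def mult.assoc)
    also have "\<dots> = ennreal (peak y powr (- \<alpha>)) * ?S y" by (rule nn_integral_cmult) simp
    finally show ?case by (simp add: mult_ac)
  qed
  also have "\<dots> = (\<integral>\<^sup>+y. G (polar y) \<partial>L)"
    by (rule cluster_formula_anchored[symmetric, OF G G_hom])
  finally show ?thesis .
qed

end

section \<open>Inequalities for powers\<close>

text \<open>Divide by $(a+b)^p$ and use $x \le x^p$ on $[0,1]$.\<close>

lemma powr_subadditive:
  fixes a b :: real
  assumes "0 \<le> a" "0 \<le> b" "0 < p" "p \<le> 1"
  shows "(a + b) powr p \<le> a powr p + b powr p"
proof (cases "a + b = 0")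
  case False
  then have s: "a + b > 0" using assms by simp
  have "x / (a + b) \<le> x powr p / (a + b) powr p" if "0 \<le> x" "x \<le> a + b" for x
  proof -
    have "(x / (a + b)) powr 1 \<le> (x / (a + b)) powr p"
      using that s assms by (intro powr_mono') auto
    then show ?thesis using that s by (simp add: powr_divide)
  qed
  note le = this
  have "1 = a / (a + b) + b / (a + b)" using s by (simp add: add_divide_distrib[symmetric])
  also have "\<dots> \<le> a powr p / (a + b) powr p + b powr p / (a + b) powr p"
    using assms by (intro add_mono le) auto
  also have "\<dots> = (a powr p + b powr p) / (a + b) powr p" by (simp add: add_divide_distrib)
  finally have "1 \<le> (a powr p + b powr p) / (a + b) powr p" .
  then show ?thesis using s by (simp add: le_divide_eq)
qed (use assms in auto)

lemma powr_sum_subadditive: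
  fixes f :: "'i \<Rightarrow> real"
  assumes "finite A" "\<And>i. 0 \<le> f i" "0 < p" "p \<le> 1"
  shows "(\<Sum>i\<in>A. f i) powr p \<le> (\<Sum>i\<in>A. f i powr p)"
  using assms(1)
proof induction
  case (insert x A)
  have "(f x + sum f A) powr p \<le> f x powr p + sum f A powr p"
    using assms by (intro powr_subadditive sum_nonneg) auto
  with insert show ?case by simp
qed simp

text \<open>Mean value theorem with an increasing derivative. The point $b = 0$, where the power need not be
  differentiable, is treated directly.\<close>

lemma powr_diff_le:
  fixes a b :: real
  assumes "0 \<le> b" "b \<le> a" "1 \<le> p"
  shows "a powr p - b powr p \<le> p * (a - b) * a powr (p - 1)"
proof (cases "b = 0 \<or> a = b")
  case True
  have "a powr p = a * a powr (p - 1)" using assms by (cases "a = 0") (auto simp: powr_diff)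
  moreover have "1 * (a * a powr (p - 1)) \<le> p * (a * a powr (p - 1))"
    using assms by (intro mult_right_mono) auto
  ultimately show ?thesis using True assms by (auto simp: mult.assoc)
next
  case False
  then have b: "0 < b" "b < a" using assms by auto
  have "\<And>x. b \<le> x \<Longrightarrow> x \<le> a \<Longrightarrow> DERIV (\<lambda>x. x powr p) x :> p * x powr (p - 1)"
    using b by (auto intro!: has_real_derivative_powr)
  from MVT2[OF b(2) this] obtain z where z: "b < z" "z < a" "a powr p - b powr p = (a - b) * (p * z powr (p - 1))"
    by blast
  have "z powr (p - 1) \<le> a powr (p - 1)" using z b assms by (intro powr_mono2) auto
  then have "(a - b) * (p * z powr (p - 1)) \<le> (a - b) * (p * a powr (p - 1))"
    using b assms by (intro mult_left_mono) auto
  with z show ?thesis by (simp add: mult_ac)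
qed

lemma abs_powr_diff_le_small:
  fixes a b :: real
  assumes "0 \<le> a" "0 \<le> b" "0 < p" "p \<le> 1"
  shows "\<bar>a powr p - b powr p\<bar> \<le> \<bar>a - b\<bar> powr p"
  using powr_subadditive[of b "a - b" p] powr_subadditive[of a "b - a" p] assms
    powr_mono2[of p a b] powr_mono2[of p b a]
  by (cases "b \<le> a") (auto simp: abs_if)

lemma abs_powr_diff_le_large:
  fixes a b :: real
  assumes "0 \<le> a" "0 \<le> b" "1 \<le> p" "a \<le> s" "b \<le> s"
  shows "\<bar>a powr p - b powr p\<bar> \<le> p * \<bar>a - b\<bar> * s powr (p - 1)"
proof -
  have *: "y powr p \<le> x powr p \<and> x powr p - y powr p \<le> p * (x - y) * s powr (p - 1)"
    if "0 \<le> y" "y \<le> x" "x \<le> s" for x y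
  proof
    show "y powr p \<le> x powr p" using that assms by (intro powr_mono2) auto
    have "x powr p - y powr p \<le> p * (x - y) * x powr (p - 1)"
      using that assms by (intro powr_diff_le) auto
    also have "\<dots> \<le> p * (x - y) * s powr (p - 1)"
      using that assms by (intro mult_left_mono powr_mono2) auto
    finally show "x powr p - y powr p \<le> p * (x - y) * s powr (p - 1)" .
  qed
  show ?thesis using *[of a b] *[of b a] assms by (cases "a \<le> b") (auto simp: abs_if)
qed

text \<open>Add the terms from the right end of the window to the left; each new term increases the power of
  the partial sum by at most the amount in \<open>powr_diff_le\<close>.\<close>

lemma powr_sum_le_telescope:
  fixes f :: "int \<Rightarrow> real"
  assumes f: "\<And>j. 0 \<le> f j" and p: "1 \<le> p"
  shows "(\<Sum>j\<in>{m - int n..m}. f j) powr p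
    \<le> (\<Sum>j\<in>{m - int n..m}. p * f j * (\<Sum>k\<in>{j..m}. f k) powr (p - 1))"
proof (induction n)
  case 0
  show ?case using powr_diff_le[of 0 "f m" p] f p by simp
next
  case (Suc n)
  let ?a = "m - int (Suc n)" and ?A = "{m - int n..m}"
  have ins: "{?a..m} = insert ?a ?A" by auto
  have notin: "?a \<notin> ?A" by simp
  have s: "(\<Sum>j\<in>{?a..m}. f j) = f ?a + sum f ?A" unfolding ins using notin by simp
  have "(\<Sum>j\<in>{?a..m}. f j) powr p - sum f ?A powr p
      \<le> p * (sum f {?a..m} - sum f ?A) * sum f {?a..m} powr (p - 1)"
  proof (rule powr_diff_le[OF _ _ p])
    show "0 \<le> sum f ?A" by (intro sum_nonneg f)
    show "sum f ?A \<le> sum f {?a..m}" using s f[of ?a] by linarith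
  qed
  also have "\<dots> = p * f ?a * sum f {?a..m} powr (p - 1)" unfolding s by simp
  finally show ?case using Suc.IH notin
    by (subst (2) ins) simp
qed

lemma enn_powr_ennreal: "0 < a \<Longrightarrow> 0 \<le> r \<Longrightarrow> enn_powr (ennreal r) a = ennreal (r powr a)"
  unfolding enn_powr_def by simp

lemma enn_powr_mult: "0 < a \<Longrightarrow> 0 < c \<Longrightarrow> enn_powr (ennreal c * x) a = ennreal (c powr a) * enn_powr x a"
  unfolding enn_powr_def by (auto simp: ennreal_mult_eq_top_iff enn2real_mult powr_mult ennreal_mult ennreal_mult_top)

lemma enn_powr_mono: "0 < a \<Longrightarrow> x \<le> y \<Longrightarrow> enn_powr x a \<le> enn_powr y a"
  unfolding enn_powr_def
  by (auto simp: top_unique less_top intro!: ennreal_leI powr_mono2 enn2real_mono)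

lemma enn_powr_measurable [measurable]: "(\<lambda>x. enn_powr x a) \<in> borel_measurable borel"
  unfolding enn_powr_def by measurable

lemma enn_powr_eq_top: "0 < a \<Longrightarrow> enn_powr x a = \<infinity> \<longleftrightarrow> x = \<infinity>"
  unfolding enn_powr_def by auto

section \<open>Sums over the integers\<close>

lemma nn_integral_count_space_finite_set:
  "finite A \<Longrightarrow> (\<integral>\<^sup>+j. f j * indicator A j \<partial>count_space UNIV) = (\<Sum>j\<in>A. f j)"
  by (simp add: nn_integral_count_space_indicator[symmetric] nn_integral_count_space_finite)

lemma sum_window_LIMSEQ:
  fixes f :: "int \<Rightarrow> ennreal"
  shows "(\<lambda>n. \<Sum>j\<in>{- int n..int n}. f j) \<longlonglongrightarrow> (\<integral>\<^sup>+j. f j \<partial>count_space UNIV)"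
proof -
  have "(\<lambda>n. \<integral>\<^sup>+j. f j * indicator {- int n..int n} j \<partial>count_space UNIV) \<longlonglongrightarrow> (\<integral>\<^sup>+j. f j \<partial>count_space UNIV)"
  proof (rule nn_integral_LIMSEQ)
    show "incseq (\<lambda>n j. f j * indicator {- int n..int n} j)"
      by (intro incseq_SucI le_funI mult_left_mono) (auto simp: indicator_def)
    fix j
    show "(\<lambda>n. f j * indicator {- int n..int n} j) \<longlonglongrightarrow> f j"
      by (intro tendsto_eventually eventually_sequentiallyI[of "nat \<bar>j\<bar>"]) (auto simp: indicator_def)
  qed simp
  then show ?thesis by (simp add: nn_integral_count_space_finite_set)
qed

text \<open>As an integral against counting measure the sum commutes with other integrals.\<close>

lemma sum_norm_eq: "sum_norm N J x = (\<integral>\<^sup>+j. ennreal (N (x j)) * indicator J j \<partial>count_space UNIV)"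
proof (rule antisym)
  have "sum_norm N J x = (SUP F\<in>{F. finite F \<and> F \<subseteq> J}. \<Sum>j\<in>F. ennreal (N (x j)))"
    unfolding sum_norm_def by (rule nonneg_infsum_complete) simp
  note S = this
  show "sum_norm N J x \<le> (\<integral>\<^sup>+j. ennreal (N (x j)) * indicator J j \<partial>count_space UNIV)"
    unfolding S
  proof (rule SUP_least)
    fix F assume F: "F \<in> {F. finite F \<and> F \<subseteq> J}"
    then have "(\<Sum>j\<in>F. ennreal (N (x j))) = (\<integral>\<^sup>+j. ennreal (N (x j)) * indicator F j \<partial>count_space UNIV)"
      by (simp add: nn_integral_count_space_finite_set)
    also have "\<dots> \<le> (\<integral>\<^sup>+j. ennreal (N (x j)) * indicator J j \<partial>count_space UNIV)"
      using F by (intro nn_integral_mono mult_left_mono) (auto simp: indicator_def)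
    finally show "(\<Sum>j\<in>F. ennreal (N (x j))) \<le> (\<integral>\<^sup>+j. ennreal (N (x j)) * indicator J j \<partial>count_space UNIV)" .
  qed
  show "(\<integral>\<^sup>+j. ennreal (N (x j)) * indicator J j \<partial>count_space UNIV) \<le> sum_norm N J x"
  proof (rule LIMSEQ_le_const2[OF sum_window_LIMSEQ], intro exI allI impI)
    fix n :: nat
    have "(\<Sum>j\<in>{- int n..int n}. ennreal (N (x j)) * indicator J j)
        = (\<Sum>j\<in>{- int n..int n} \<inter> J. ennreal (N (x j)))"
      by (intro sum.mono_neutral_cong_right) auto
    also have "\<dots> \<le> sum_norm N J x" unfolding S by (rule SUP_upper) auto
    finally show "(\<Sum>j\<in>{- int n..int n}. ennreal (N (x j)) * indicator J j) \<le> sum_norm N J x" .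
  qed
qed

lemma sum_norm_measurable [measurable]:
  assumes "is_norm N" shows "sum_norm N J \<in> borel_measurable borel"
proof -
  have [measurable]: "N \<in> borel_measurable borel" by (rule is_norm_measurable[OF assms])
  show ?thesis unfolding sum_norm_eq[abs_def]
    by (rule borel_measurable_nn_integral_countable) measurable
qed

lemma sum_norm_scale:
  "is_norm N \<Longrightarrow> 0 < c \<Longrightarrow> sum_norm N J (\<lambda>k. c *\<^sub>R x k) = ennreal c * sum_norm N J x"
  unfolding sum_norm_eq
  by (subst nn_integral_cmult[symmetric]) (auto simp: is_norm_scale is_norm_nonneg ennreal_mult mult.assoc)

lemma sum_norm_rescale: "sum_norm N {0..} (rescale 1 (- j) x) = sum_norm N {j..} x"
proof -
  have "sum_norm N {0..} (rescale 1 (- j) x)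
      = (\<integral>\<^sup>+k. (\<lambda>i. ennreal (N (x i)) * indicator {j..} i) (k + j) \<partial>count_space UNIV)"
    unfolding sum_norm_eq rescale_def by (intro nn_integral_cong) (simp add: indicator_def)
  also have "\<dots> = sum_norm N {j..} x" unfolding sum_norm_eq
    by (rule nn_integral_bij_count_space) (rule bij_betw_byWitness[where f' = "\<lambda>k. k - j"]; auto)
  finally show ?thesis .
qed

text \<open>Bounds on powers of symmetric partial sums pass to the full sum; in particular a finite bound
  forces the full sum to be finite.\<close>

lemma enn_powr_sum_norm_le:
  assumes N: "is_norm N" and a: "0 < a"
    and le: "\<And>n. ennreal ((\<Sum>j\<in>{- int n..int n}. N (x j)) powr a) \<le> B"
  shows "enn_powr (sum_norm N UNIV x) a \<le> B"
proof (cases "B = \<infinity>")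
  case False
  then obtain b where b: "0 \<le> b" "B = ennreal b" by (cases B) auto
  have "sum_norm N UNIV x \<le> ennreal (b powr (1 / a))"
    unfolding sum_norm_eq
  proof (rule LIMSEQ_le_const2[OF sum_window_LIMSEQ], intro exI allI impI)
    fix n :: nat
    let ?s = "\<Sum>j\<in>{- int n..int n}. N (x j)"
    have s: "0 \<le> ?s" by (intro sum_nonneg is_norm_nonneg[OF N])
    have "?s powr a \<le> b" using le[of n] b by simp
    then have "(?s powr a) powr (1 / a) \<le> b powr (1 / a)" using a by (intro powr_mono2) auto
    then have "?s \<le> b powr (1 / a)" using a s by (simp add: powr_powr)
    then show "(\<Sum>j\<in>{- int n..int n}. ennreal (N (x j)) * indicator UNIV j) \<le> ennreal (b powr (1 / a))"
      by (simp add: sum_ennreal is_norm_nonneg[OF N] ennreal_leI)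
  qed
  then have "enn_powr (sum_norm N UNIV x) a \<le> enn_powr (ennreal (b powr (1 / a))) a"
    by (rule enn_powr_mono[OF a])
  also have "\<dots> = B" using a b by (simp add: enn_powr_ennreal powr_powr)
  finally show ?thesis .
qed simp

section \<open>The moment of the cluster sum\<close>

context tail_law
begin

lemma AE_polar_anchor: "AE y in L. N (polar y 0) = 1"
  using AE_radius by eventually_elim (simp add: polar_def is_norm_scale[OF norm])

text \<open>The cluster formula for $G(y) = |y_0|^\alpha$ shows that $\sum_j |Q_j|^\alpha$ has mean
  $1/\vartheta$, and for $\alpha \le 1$ this sum dominates $(\sum_j |Q_j|)^\alpha$.\<close>

lemma cluster_sum_moment_small:
  assumes pos: "extremal_index > 0" and "\<alpha> \<le> 1"
  shows "(\<integral>\<^sup>+q. enn_powr (sum_norm N UNIV q) \<alpha> \<partial>cluster_law) < \<infinity>"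
proof -
  define G :: "(int \<Rightarrow> real ^ 'n) \<Rightarrow> ennreal" where "G y = ennreal (N (y 0) powr \<alpha>)" for y
  let ?S = "\<lambda>q. \<integral>\<^sup>+j. G (rescale 1 (- j) q) * indicator {j. q j \<noteq> 0} j \<partial>count_space UNIV"
  have S: "?S q = (\<integral>\<^sup>+j. ennreal (N (q j) powr \<alpha>) \<partial>count_space UNIV)" for q
    unfolding G_def rescale_def using alpha_pos
    by (intro nn_integral_cong) (auto simp: indicator_def is_norm_zero[OF norm])
  have "(\<integral>\<^sup>+q. enn_powr (sum_norm N UNIV q) \<alpha> \<partial>cluster_law) \<le> (\<integral>\<^sup>+q. ?S q \<partial>cluster_law)"
  proof (intro nn_integral_mono enn_powr_sum_norm_le[OF norm alpha_pos])
    fix q :: "int \<Rightarrow> real ^ 'n" and n :: nat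
    have "ennreal ((\<Sum>j\<in>{- int n..int n}. N (q j)) powr \<alpha>) \<le> ennreal (\<Sum>j\<in>{- int n..int n}. N (q j) powr \<alpha>)"
      using alpha_pos assms(2) by (intro ennreal_leI powr_sum_subadditive) (auto simp: is_norm_nonneg[OF norm])
    also have "\<dots> = (\<Sum>j\<in>{- int n..int n}. ennreal (N (q j) powr \<alpha>))" by (simp add: sum_ennreal)
    also have "\<dots> = (\<integral>\<^sup>+j. ennreal (N (q j) powr \<alpha>) * indicator {- int n..int n} j \<partial>count_space UNIV)"
      by (simp add: nn_integral_count_space_finite_set)
    also have "\<dots> \<le> ?S q" unfolding S by (intro nn_integral_mono) (simp add: indicator_def)
    finally show "ennreal ((\<Sum>j\<in>{- int n..int n}. N (q j)) powr \<alpha>) \<le> ?S q" .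
  qed
  moreover have "ennreal extremal_index * (\<integral>\<^sup>+q. ?S q \<partial>cluster_law) = (\<integral>\<^sup>+y. G (polar y) \<partial>L)"
  proof (rule cluster_formula[OF pos])
    show "G \<in> borel_measurable borel" unfolding G_def by measurable
    show "G (\<lambda>k. c *\<^sub>R y k) = ennreal (c powr \<alpha>) * G y" if "0 < c" for c y
      unfolding G_def using that
      by (simp add: is_norm_scale[OF norm] powr_mult is_norm_nonneg[OF norm] ennreal_mult)
  qed
  moreover have "(\<integral>\<^sup>+y. G (polar y) \<partial>L) = (\<integral>\<^sup>+y. 1 \<partial>L)"
    using AE_polar_anchor by (intro nn_integral_cong_AE, eventually_elim) (simp add: G_def)
  ultimately show ?thesis using pos emeasure_space_1
    by (auto simp: less_top[symmetric] ennreal_mult_eq_top_iff top_unique)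
qed

text \<open>The cluster formula for $G(y) = \alpha |y_0| (\sum_{k \ge 0} |y_k|)^{\alpha - 1}$; the sum over its
  shifts dominates $(\sum_j |Q_j|)^\alpha$ by \<open>powr_sum_le_telescope\<close>, also when some
  of the tail sums are infinite.\<close>

lemma cluster_sum_moment_large:
  assumes pos: "extremal_index > 0" and "1 < \<alpha>"
    and fin: "(\<integral>\<^sup>+y. enn_powr (sum_norm N {0..} (polar y)) (\<alpha> - 1) \<partial>L) < \<infinity>"
  shows "(\<integral>\<^sup>+q. enn_powr (sum_norm N UNIV q) \<alpha> \<partial>cluster_law) < \<infinity>"
proof -
  have [measurable]: "sum_norm N J \<in> borel_measurable borel" for J by (rule sum_norm_measurable[OF norm])
  define G :: "(int \<Rightarrow> real ^ 'n) \<Rightarrow> ennreal"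
    where "G y = ennreal (\<alpha> * N (y 0)) * enn_powr (sum_norm N {0..} y) (\<alpha> - 1)" for y
  let ?S = "\<lambda>q. \<integral>\<^sup>+j. G (rescale 1 (- j) q) * indicator {j. q j \<noteq> 0} j \<partial>count_space UNIV"
  have S: "?S q = (\<integral>\<^sup>+j. ennreal (\<alpha> * N (q j)) * enn_powr (sum_norm N {j..} q) (\<alpha> - 1) \<partial>count_space UNIV)" for q
    unfolding G_def sum_norm_rescale using is_norm_zero[OF norm, of 0]
    by (intro nn_integral_cong) (auto simp: indicator_def rescale_def)
  have le: "(\<integral>\<^sup>+q. enn_powr (sum_norm N UNIV q) \<alpha> \<partial>cluster_law) \<le> (\<integral>\<^sup>+q. ?S q \<partial>cluster_law)"
  proof (intro nn_integral_mono enn_powr_sum_norm_le[OF norm alpha_pos])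
    fix q :: "int \<Rightarrow> real ^ 'n" and n :: nat
    let ?I = "{- int n..int n}"
    have "(\<Sum>j\<in>?I. N (q j)) powr \<alpha> \<le> (\<Sum>j\<in>?I. \<alpha> * N (q j) * (\<Sum>k\<in>{j..int n}. N (q k)) powr (\<alpha> - 1))"
      using powr_sum_le_telescope[of "\<lambda>j. N (q j)" \<alpha> "int n" "2 * n"] assms(2) is_norm_nonneg[OF norm] by simp
    then have "ennreal ((\<Sum>j\<in>?I. N (q j)) powr \<alpha>)
        \<le> ennreal (\<Sum>j\<in>?I. \<alpha> * N (q j) * (\<Sum>k\<in>{j..int n}. N (q k)) powr (\<alpha> - 1))" by (rule ennreal_leI)
    also have "\<dots> = (\<Sum>j\<in>?I. ennreal (\<alpha> * N (q j)) * ennreal ((\<Sum>k\<in>{j..int n}. N (q k)) powr (\<alpha> - 1)))"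
      using alpha_pos is_norm_nonneg[OF norm] by (simp add: sum_ennreal[symmetric] ennreal_mult)
    also have "\<dots> \<le> (\<Sum>j\<in>?I. ennreal (\<alpha> * N (q j)) * enn_powr (sum_norm N {j..} q) (\<alpha> - 1))"
    proof (intro sum_mono mult_left_mono)
      fix j
      have "ennreal (\<Sum>k\<in>{j..int n}. N (q k)) = (\<integral>\<^sup>+k. ennreal (N (q k)) * indicator {j..int n} k \<partial>count_space UNIV)"
        by (simp add: nn_integral_count_space_finite_set is_norm_nonneg[OF norm])
      also have "\<dots> \<le> sum_norm N {j..} q" unfolding sum_norm_eq
        by (intro nn_integral_mono mult_left_mono) (auto simp: indicator_def)
      finally have "enn_powr (ennreal (\<Sum>k\<in>{j..int n}. N (q k))) (\<alpha> - 1) \<le> enn_powr (sum_norm N {j..} q) (\<alpha> - 1)"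
        using assms(2) by (intro enn_powr_mono) auto
      then show "ennreal ((\<Sum>k\<in>{j..int n}. N (q k)) powr (\<alpha> - 1)) \<le> enn_powr (sum_norm N {j..} q) (\<alpha> - 1)"
        using assms(2) by (simp add: enn_powr_ennreal sum_nonneg is_norm_nonneg[OF norm])
    qed simp
    also have "\<dots> = (\<integral>\<^sup>+j. ennreal (\<alpha> * N (q j)) * enn_powr (sum_norm N {j..} q) (\<alpha> - 1) * indicator ?I j \<partial>count_space UNIV)"
      by (simp add: nn_integral_count_space_finite_set)
    also have "\<dots> \<le> ?S q" unfolding S by (intro nn_integral_mono) (simp add: indicator_def)
    finally show "ennreal ((\<Sum>j\<in>{- int n..int n}. N (q j)) powr \<alpha>) \<le> ?S q" .
  qed
  have "ennreal extremal_index * (\<integral>\<^sup>+q. ?S q \<partial>cluster_law) = (\<integral>\<^sup>+y. G (polar y) \<partial>L)"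
  proof (rule cluster_formula[OF pos])
    show "G \<in> borel_measurable borel" unfolding G_def by measurable
    show "G (\<lambda>k. c *\<^sub>R y k) = ennreal (c powr \<alpha>) * G y" if c: "0 < c" for c y
    proof -
      have "G (\<lambda>k. c *\<^sub>R y k) = (ennreal c * ennreal (c powr (\<alpha> - 1))) * G y"
        unfolding G_def using c assms(2) alpha_pos
        by (simp add: is_norm_scale[OF norm] is_norm_nonneg[OF norm] sum_norm_scale[OF norm]
            enn_powr_mult ennreal_mult mult_ac)
      also have "ennreal c * ennreal (c powr (\<alpha> - 1)) = ennreal (c powr \<alpha>)"
        using c by (simp add: ennreal_mult[symmetric] powr_diff)
      finally show ?thesis .
    qed
  qed
  moreover have "(\<integral>\<^sup>+y. G (polar y) \<partial>L) = (\<integral>\<^sup>+y. ennreal \<alpha> * enn_powr (sum_norm N {0..} (polar y)) (\<alpha> - 1) \<partial>L)"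
    using AE_polar_anchor by (intro nn_integral_cong_AE, eventually_elim) (simp add: G_def)
  moreover have "\<dots> = ennreal \<alpha> * (\<integral>\<^sup>+y. enn_powr (sum_norm N {0..} (polar y)) (\<alpha> - 1) \<partial>L)"
    by (rule nn_integral_cmult) measurable
  moreover have "ennreal \<alpha> * (\<integral>\<^sup>+y. enn_powr (sum_norm N {0..} (polar y)) (\<alpha> - 1) \<partial>L) \<noteq> \<infinity>"
    using fin by (simp add: ennreal_mult_eq_top_iff)
  ultimately have "ennreal extremal_index * (\<integral>\<^sup>+q. ?S q \<partial>cluster_law) \<noteq> \<infinity>" by simp
  then have "(\<integral>\<^sup>+q. ?S q \<partial>cluster_law) < \<infinity>"
    using pos by (auto simp: ennreal_mult_eq_top_iff less_top)
  with le show ?thesis by (rule order.strict_trans1)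
qed

lemma cluster_sum_moment:
  assumes pos: "extremal_index > 0"
    and fin: "(\<integral>\<^sup>+q. enn_powr (sum_norm N UNIV q) \<alpha> \<partial>cluster_law) < \<infinity> \<or>
      (\<integral>\<^sup>+y. enn_powr (sum_norm N {0..} (polar y)) (\<alpha> - 1) \<partial>L) < \<infinity>"
  shows "(\<integral>\<^sup>+q. enn_powr (sum_norm N UNIV q) \<alpha> \<partial>cluster_law) < \<infinity>"
  using fin cluster_sum_moment_small[OF pos] cluster_sum_moment_large[OF pos] by linarith

end

section \<open>Truncations of a Lipschitz functional\<close>

locale lipschitz_functional =
  fixes N :: "real ^ 'n \<Rightarrow> real" and H :: "(int \<Rightarrow> real ^ 'n) \<Rightarrow> real" and C \<alpha> :: real
  assumes norm: "is_norm N" and alpha_pos: "\<alpha> > 0"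
    and H_measurable [measurable]: "H \<in> borel_measurable borel" and H_nonneg: "\<And>x. H x \<ge> 0"
    and H_shift_invariant: "shift_invariant H" and H_homogeneous: "one_homogeneous H"
    and C_pos: "C > 0"
    and H_lipschitz: "\<And>x y. ennreal \<bar>H x - H y\<bar> \<le> ennreal C * sum_norm N UNIV (\<lambda>j. x j - y j)"
begin

lemma H_scale: "0 < t \<Longrightarrow> H (\<lambda>j. t *\<^sub>R x j) = t * H x"
  using H_homogeneous unfolding one_homogeneous_def by blast

lemma H_zero: "H (\<lambda>_. 0) = 0"
  using H_scale[of 2 "\<lambda>_. 0"] by simp

lemma H_shift: "H (\<lambda>k. x (k + i)) = H x" for i :: int
proof (induction i rule: int_induct[where k = 0])
  case (step1 i)
  have "H (\<lambda>j. (\<lambda>k. x (k + (i + 1))) (j - 1)) = H (\<lambda>k. x (k + (i + 1)))"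
    by (rule H_shift_invariant[unfolded shift_invariant_def, rule_format])
  with step1 show ?case by (simp add: add.assoc)
next
  case (step2 i)
  have "H (\<lambda>j. (\<lambda>k. x (k + i)) (j - 1)) = H (\<lambda>k. x (k + i))"
    by (rule H_shift_invariant[unfolded shift_invariant_def, rule_format])
  with step2 show ?case by (simp add: algebra_simps)
qed simp

lemma H_diff_le:
  assumes "sum_norm N UNIV (\<lambda>j. x j - y j) \<le> ennreal s" "0 \<le> s"
  shows "\<bar>H x - H y\<bar> \<le> C * s"
proof -
  have "ennreal \<bar>H x - H y\<bar> \<le> ennreal C * ennreal s"
    by (rule order.trans[OF H_lipschitz]) (intro mult_left_mono assms, simp)
  also have "\<dots> = ennreal (C * s)" using C_pos assms by (simp add: ennreal_mult)
  finally show ?thesis using C_pos assms by (simp add: ennreal_le_iff)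
qed

lemma zero_before_measurable [measurable]: "zero_before j \<in> borel_measurable (borel :: (int \<Rightarrow> real ^ 'n) measure)"
  unfolding zero_before_def[abs_def] by (rule measurable_coordinatewise_then_product) measurable

text \<open>$K(x_{j,\infty})$ for $K = H^\alpha$.\<close>

definition tail_power :: "int \<Rightarrow> (int \<Rightarrow> real ^ 'n) \<Rightarrow> real" where
  "tail_power j x = H (zero_before j x) powr \<alpha>"

lemma tail_power_measurable [measurable]: "tail_power j \<in> borel_measurable borel"
  unfolding tail_power_def[abs_def] by measurable

lemma tail_power_shift: "tail_power i (rescale 1 (- j) x) = tail_power (i + j) x"
proof -
  have "zero_before i (rescale 1 (- j) x) = (\<lambda>k. zero_before (i + j) x (k + j))"
    by (auto simp: zero_before_def rescale_def fun_eq_iff)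
  then show ?thesis unfolding tail_power_def by (simp add: H_shift)
qed

lemma tail_power_scale: assumes "0 < c" shows "tail_power j (\<lambda>k. c *\<^sub>R x k) = c powr \<alpha> * tail_power j x"
proof -
  have "zero_before j (\<lambda>k. c *\<^sub>R x k) = (\<lambda>k. c *\<^sub>R zero_before j x k)"
    by (auto simp: zero_before_def fun_eq_iff)
  then show ?thesis using assms unfolding tail_power_def
    by (simp add: H_scale powr_mult H_nonneg)
qed

lemma tail_power_const: assumes "x j = 0" shows "tail_power (j + 1) x = tail_power j x"
proof -
  have "zero_before (j + 1) x = zero_before j x"
    using assms by (auto simp: zero_before_def fun_eq_iff)
  then show ?thesis unfolding tail_power_def by simp
qed

lemma N_zero: "N 0 = 0" using is_norm_zero[OF norm, of 0] by simp

lemma H_tail_step: "\<bar>H (zero_before j x) - H (zero_before (j + 1) x)\<bar> \<le> C * N (x j)"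
proof (rule H_diff_le)
  have "sum_norm N UNIV (\<lambda>k. zero_before j x k - zero_before (j + 1) x k)
      = (\<integral>\<^sup>+k. ennreal (N (x j)) * indicator {j} k \<partial>count_space UNIV)"
    unfolding sum_norm_eq
    by (intro nn_integral_cong) (auto simp: zero_before_def indicator_def N_zero)
  then show "sum_norm N UNIV (\<lambda>k. zero_before j x k - zero_before (j + 1) x k) \<le> ennreal (N (x j))"
    by (simp add: nn_integral_count_space_finite_set)
qed (rule is_norm_nonneg[OF norm])

lemma H_le:
  assumes "sum_norm N UNIV x \<le> ennreal s" "0 \<le> s" shows "H x \<le> C * s"
  using H_diff_le[of x "\<lambda>_. 0" s] assms by (simp add: H_zero)

lemma sum_norm_zero_before: "sum_norm N UNIV (zero_before j x) \<le> sum_norm N UNIV x"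
  unfolding sum_norm_eq by (intro nn_integral_mono) (simp add: zero_before_def N_zero)

text \<open>Both $x_{n+1,\infty}$ and $x - x_{-n,\infty}$ have a sum of norms of at most
  $\sum_{|j| > n} |x_j|$, which tends to zero.\<close>

lemma tail_power_limits:
  assumes fin: "sum_norm N UNIV x < \<infinity>"
  shows "(\<lambda>n. tail_power (int n + 1) x) \<longlonglongrightarrow> 0" "(\<lambda>n. tail_power (- int n) x) \<longlonglongrightarrow> H x powr \<alpha>"
proof -
  define T where "T n = (\<integral>\<^sup>+j. ennreal (N (x j)) * indicator {j. int n < \<bar>j\<bar>} j \<partial>count_space UNIV)" for n
  have "T \<longlonglongrightarrow> (\<integral>\<^sup>+j. 0 \<partial>count_space (UNIV :: int set))"
    unfolding T_def[abs_def]
  proof (rule nn_integral_dominated_convergence[where w = "\<lambda>j. ennreal (N (x j))"])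
    show "(\<integral>\<^sup>+j. ennreal (N (x j)) \<partial>count_space UNIV) < \<infinity>" using fin by (simp add: sum_norm_eq)
    show "AE j in count_space UNIV. (\<lambda>n. ennreal (N (x j)) * indicator {j. int n < \<bar>j\<bar>} j) \<longlonglongrightarrow> 0"
    proof (intro AE_I2 tendsto_eventually)
      fix j :: int
      show "eventually (\<lambda>n. ennreal (N (x j)) * indicator {j. int n < \<bar>j\<bar>} j = 0) sequentially"
        by (intro eventually_sequentiallyI[of "nat \<bar>j\<bar>"]) auto
    qed
  qed (auto simp: indicator_def)
  then have T: "T \<longlonglongrightarrow> 0" by simp
  have T_fin: "T n < \<infinity>" for n
    using fin unfolding T_def sum_norm_eq
    by (rule order.strict_trans1[rotated]) (intro nn_integral_mono, simp add: indicator_def)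
  have "(\<lambda>n. enn2real (T n)) \<longlonglongrightarrow> 0" by (rule tendsto_enn2real) (use T in simp_all)
  then have rT: "(\<lambda>n. C * enn2real (T n)) \<longlonglongrightarrow> 0" by (rule tendsto_mult_right_zero)
  have T_eq: "ennreal (enn2real (T n)) = T n" for n using T_fin by simp
  have up: "\<bar>H (zero_before (int n + 1) x) - 0\<bar> \<le> C * enn2real (T n)" for n
  proof -
    have "sum_norm N UNIV (zero_before (int n + 1) x) \<le> T n"
      unfolding sum_norm_eq T_def
      by (intro nn_integral_mono) (auto simp: zero_before_def indicator_def N_zero)
    then show ?thesis using H_le[of "zero_before (int n + 1) x" "enn2real (T n)"] H_nonneg T_eq by simp
  qed
  have dn: "\<bar>H (zero_before (- int n) x) - H x\<bar> \<le> C * enn2real (T n)" for n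
  proof (rule H_diff_le)
    have "sum_norm N UNIV (\<lambda>j. zero_before (- int n) x j - x j) \<le> T n"
      unfolding sum_norm_eq T_def using is_norm_scale[OF norm, of "- 1"]
      by (intro nn_integral_mono) (auto simp: zero_before_def indicator_def N_zero)
    then show "sum_norm N UNIV (\<lambda>j. zero_before (- int n) x j - x j) \<le> ennreal (enn2real (T n))"
      by (simp add: T_eq)
  qed simp
  have "(\<lambda>n. H (zero_before (int n + 1) x)) \<longlonglongrightarrow> 0"
    by (rule Lim_null_comparison[OF _ rT]) (use up in \<open>auto intro!: always_eventually\<close>)
  then show "(\<lambda>n. tail_power (int n + 1) x) \<longlonglongrightarrow> 0"
    unfolding tail_power_def using tendsto_powr'[OF _ tendsto_const, of _ 0 sequentially \<alpha>] alpha_pos H_nonneg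
    by (simp add: always_eventually)
  have "(\<lambda>n. H (zero_before (- int n) x) - H x) \<longlonglongrightarrow> 0"
    by (rule Lim_null_comparison[OF _ rT]) (use dn in \<open>auto intro!: always_eventually\<close>)
  then have "(\<lambda>n. H (zero_before (- int n) x)) \<longlonglongrightarrow> H x" by (simp add: LIM_zero_iff)
  then show "(\<lambda>n. tail_power (- int n) x) \<longlonglongrightarrow> H x powr \<alpha>"
    unfolding tail_power_def using alpha_pos H_nonneg
    by (intro tendsto_powr'[OF _ tendsto_const]) (auto intro!: always_eventually)
qed

text \<open>In every window $[-n,n]$ the positive and the negative increments differ by two boundary terms, which
  converge by \<open>tail_power_limits\<close>. Keeping the two signs on opposite sides of the equation
  makes it valid in $[0,\infty]$, before any absolute convergence is known.\<close>

lemma tail_power_telescope: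
  assumes fin: "sum_norm N UNIV x < \<infinity>"
  shows "(\<integral>\<^sup>+j. ennreal (tail_power j x - tail_power (j + 1) x) \<partial>count_space UNIV)
    = ennreal (H x powr \<alpha>) + (\<integral>\<^sup>+j. ennreal (tail_power (j + 1) x - tail_power j x) \<partial>count_space UNIV)"
proof -
  let ?k = "\<lambda>j. tail_power j x"
  have tele: "(\<Sum>j\<in>{- int n..int n}. ?k j - ?k (j + 1)) = ?k (- int n) - ?k (int n + 1)" for n
  proof (induction n)
    case (Suc n)
    have "{- int (Suc n)..int (Suc n)} = insert (- int (Suc n)) (insert (int (Suc n)) {- int n..int n})" by auto
    with Suc.IH show ?case by (simp add: algebra_simps)
  qed simp
  have fin_eq: "(\<Sum>j\<in>{- int n..int n}. ennreal (?k j - ?k (j + 1))) + ennreal (?k (int n + 1))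
      = ennreal (?k (- int n)) + (\<Sum>j\<in>{- int n..int n}. ennreal (?k (j + 1) - ?k j))" for n
  proof -
    let ?I = "{- int n..int n}"
    have k0: "0 \<le> ?k j" for j unfolding tail_power_def by simp
    have "(\<Sum>j\<in>?I. max 0 (?k j - ?k (j + 1))) - (\<Sum>j\<in>?I. max 0 (?k (j + 1) - ?k j))
       = (\<Sum>j\<in>?I. ?k j - ?k (j + 1))"
      unfolding sum_subtractf[symmetric] by (intro sum.cong) (auto simp: max_def)
    then have "(\<Sum>j\<in>?I. max 0 (?k j - ?k (j + 1))) + ?k (int n + 1)
       = ?k (- int n) + (\<Sum>j\<in>?I. max 0 (?k (j + 1) - ?k j))"
      using tele[of n] by linarith
    then have "ennreal ((\<Sum>j\<in>?I. max 0 (?k j - ?k (j + 1))) + ?k (int n + 1))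
       = ennreal (?k (- int n) + (\<Sum>j\<in>?I. max 0 (?k (j + 1) - ?k j)))" by simp
    then show ?thesis
      using k0 by (simp add: ennreal_plus sum_nonneg sum_ennreal[symmetric])
  qed
  have "(\<lambda>n. (\<Sum>j\<in>{- int n..int n}. ennreal (?k j - ?k (j + 1))) + ennreal (?k (int n + 1)))
     \<longlonglongrightarrow> (\<integral>\<^sup>+j. ennreal (?k j - ?k (j + 1)) \<partial>count_space UNIV) + ennreal 0"
    by (intro tendsto_add sum_window_LIMSEQ tendsto_ennrealI tail_power_limits[OF fin])
  moreover have "(\<lambda>n. ennreal (?k (- int n)) + (\<Sum>j\<in>{- int n..int n}. ennreal (?k (j + 1) - ?k j)))
     \<longlonglongrightarrow> ennreal (H x powr \<alpha>) + (\<integral>\<^sup>+j. ennreal (?k (j + 1) - ?k j) \<partial>count_space UNIV)"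
    by (intro tendsto_add sum_window_LIMSEQ tendsto_ennrealI tail_power_limits[OF fin])
  ultimately show ?thesis unfolding fin_eq by (simp add: LIMSEQ_unique)
qed

lemma H_power_le: "ennreal (H x powr \<alpha>) \<le> ennreal (C powr \<alpha>) * enn_powr (sum_norm N UNIV x) \<alpha>"
proof (cases "sum_norm N UNIV x")
  case (real s)
  have "H x powr \<alpha> \<le> (C * s) powr \<alpha>"
    using real H_le[of x s] alpha_pos H_nonneg by (intro powr_mono2) auto
  then show ?thesis using real alpha_pos C_pos
    by (simp add: enn_powr_ennreal powr_mult ennreal_mult[symmetric] ennreal_leI)
next
  case top
  then show ?thesis using alpha_pos C_pos by (simp add: enn_powr_def ennreal_mult_top)
qed

text \<open>For $\alpha > 1$ each increment of $K$ is at most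
  $\alpha (Cs)^{\alpha-1}\, C |x_j|$ with $s = \sum_k |x_k|$, which sums to
  $\alpha C^\alpha s^\alpha$.\<close>

lemma sum_tail_power_steps_le:
  assumes "1 < \<alpha>"
  shows "(\<integral>\<^sup>+j. ennreal \<bar>tail_power j x - tail_power (j + 1) x\<bar> \<partial>count_space UNIV)
    \<le> ennreal (\<alpha> * C powr \<alpha>) * enn_powr (sum_norm N UNIV x) \<alpha>"
proof (cases "sum_norm N UNIV x")
  case (real s)
  have Hs: "H (zero_before j x) \<le> C * s" for j
    using real sum_norm_zero_before[of j x] by (intro H_le) auto
  have "\<bar>tail_power j x - tail_power (j + 1) x\<bar> \<le> (\<alpha> * C powr \<alpha> * s powr (\<alpha> - 1)) * N (x j)" for j
  proof -
    have "\<bar>tail_power j x - tail_power (j + 1) x\<bar>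
        \<le> \<alpha> * \<bar>H (zero_before j x) - H (zero_before (j + 1) x)\<bar> * (C * s) powr (\<alpha> - 1)"
      unfolding tail_power_def using assms
      by (intro abs_powr_diff_le_large Hs H_nonneg) auto
    also have "\<dots> \<le> \<alpha> * (C * N (x j)) * (C * s) powr (\<alpha> - 1)"
      using alpha_pos by (intro mult_left_mono mult_right_mono H_tail_step) auto
    also have "\<dots> = (\<alpha> * (C * C powr (\<alpha> - 1)) * s powr (\<alpha> - 1)) * N (x j)"
      using C_pos real by (simp add: powr_mult mult_ac)
    also have "C * C powr (\<alpha> - 1) = C powr \<alpha>" using C_pos by (simp add: powr_diff)
    finally show ?thesis .
  qed
  then have "(\<integral>\<^sup>+j. ennreal \<bar>tail_power j x - tail_power (j + 1) x\<bar> \<partial>count_space UNIV)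
     \<le> (\<integral>\<^sup>+j. ennreal (\<alpha> * C powr \<alpha> * s powr (\<alpha> - 1)) * ennreal (N (x j)) \<partial>count_space UNIV)"
    using alpha_pos is_norm_nonneg[OF norm]
    by (intro nn_integral_mono) (simp add: ennreal_mult[symmetric] ennreal_leI)
  also have "\<dots> = ennreal (\<alpha> * C powr \<alpha> * s powr (\<alpha> - 1)) * sum_norm N UNIV x"
    unfolding sum_norm_eq by (subst nn_integral_cmult) auto
  also have "\<dots> = ennreal (\<alpha> * C powr \<alpha> * (s powr (\<alpha> - 1) * s))"
    using real alpha_pos by (simp add: ennreal_mult[symmetric] mult_ac)
  also have "s powr (\<alpha> - 1) * s = s powr \<alpha>"
    using real by (cases "s = 0") (auto simp: powr_diff)
  finally show ?thesis using real alpha_pos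
    by (simp add: enn_powr_ennreal ennreal_mult[symmetric])
next
  case top
  then show ?thesis using alpha_pos C_pos by (simp add: enn_powr_def ennreal_mult_top)
qed

text \<open>For $\alpha \le 1$ the bound depends on $x_0$ only and is thus constant on sequences with
  $|x_0| = 1$, such as those in the range of \<open>polar\<close>.\<close>

lemma tail_power_step_le:
  assumes "\<alpha> \<le> 1"
  shows "\<bar>tail_power 0 x - tail_power 1 x\<bar> \<le> (C * N (x 0)) powr \<alpha>"
proof -
  have "\<bar>tail_power 0 x - tail_power 1 x\<bar> \<le> \<bar>H (zero_before 0 x) - H (zero_before 1 x)\<bar> powr \<alpha>"
    unfolding tail_power_def using alpha_pos assms by (intro abs_powr_diff_le_small H_nonneg)
  also have "\<dots> \<le> (C * N (x 0)) powr \<alpha>"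
    using alpha_pos H_tail_step[of 0 x] by (intro powr_mono2) auto
  finally show ?thesis .
qed

end

section \<open>The cluster index as an expectation of increments\<close>

locale cluster_functional = tail_law L N \<alpha> + F: lipschitz_functional N H C \<alpha>
  for L :: "(int \<Rightarrow> real ^ 'n) measure" and N H C \<alpha> +
  assumes extremal_index_pos: "extremal_index > 0"
    and moment: "(\<integral>\<^sup>+q. enn_powr (sum_norm N UNIV q) \<alpha> \<partial>cluster_law) < \<infinity>"
begin

abbreviation increment :: "(int \<Rightarrow> real ^ 'n) \<Rightarrow> real" where
  "increment y \<equiv> F.tail_power 0 y - F.tail_power 1 y"

text \<open>The cluster formula for the increment of $K$ at $0$. The function $\phi$ selects the positive part
  (\<open>ennreal\<close> maps negative numbers to zero), the negative part or the absolute value. A vanishing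
  coordinate gives a vanishing increment, so the condition $q_j \ne 0$ disappears.\<close>

lemma nn_integral_increment:
  assumes \<phi>[measurable]: "\<phi> \<in> borel_measurable borel" and \<phi>_hom: "\<And>c r. 0 < c \<Longrightarrow> \<phi> (c * r) = c * \<phi> r"
    and "\<phi> 0 = (0::real)"
  shows "ennreal extremal_index *
      (\<integral>\<^sup>+q. (\<integral>\<^sup>+j. ennreal (\<phi> (F.tail_power j q - F.tail_power (j + 1) q)) \<partial>count_space UNIV) \<partial>cluster_law)
    = (\<integral>\<^sup>+y. ennreal (\<phi> (increment (polar y))) \<partial>L)"
proof -
  have "ennreal (\<phi> (F.tail_power j q - F.tail_power (j + 1) q))
      = ennreal (\<phi> (increment (rescale 1 (- j) q))) * indicator {j. q j \<noteq> 0} j" for j q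
    using F.tail_power_const[of q j] \<open>\<phi> 0 = 0\<close>
    by (simp add: F.tail_power_shift indicator_def add.commute)
  then have "ennreal extremal_index *
      (\<integral>\<^sup>+q. (\<integral>\<^sup>+j. ennreal (\<phi> (F.tail_power j q - F.tail_power (j + 1) q)) \<partial>count_space UNIV) \<partial>cluster_law)
    = ennreal extremal_index * (\<integral>\<^sup>+q. (\<integral>\<^sup>+j. ennreal (\<phi> (increment (rescale 1 (- j) q))) *
        indicator {j. q j \<noteq> 0} j \<partial>count_space UNIV) \<partial>cluster_law)"
    by simp
  also have "\<dots> = (\<integral>\<^sup>+y. ennreal (\<phi> (increment (polar y))) \<partial>L)"
  proof (rule cluster_formula[OF extremal_index_pos])
    show "(\<lambda>y. ennreal (\<phi> (increment y))) \<in> borel_measurable borel" by measurable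
    fix c :: real and y :: "int \<Rightarrow> real ^ 'n" assume c: "0 < c"
    have "increment (\<lambda>k. c *\<^sub>R y k) = c powr \<alpha> * increment y"
      using c by (simp add: F.tail_power_scale algebra_simps)
    then show "ennreal (\<phi> (increment (\<lambda>k. c *\<^sub>R y k))) = ennreal (c powr \<alpha>) * ennreal (\<phi> (increment y))"
      using c by (simp add: \<phi>_hom ennreal_mult')
  qed
  finally show ?thesis .
qed

lemma AE_sum_norm_finite: "AE q in cluster_law. sum_norm N UNIV q < \<infinity>"
proof -
  have [measurable]: "sum_norm N J \<in> borel_measurable borel" for J by (rule sum_norm_measurable[OF norm])
  have "AE q in cluster_law. enn_powr (sum_norm N UNIV q) \<alpha> \<noteq> \<infinity>"
    using moment by (intro nn_integral_noteq_infinite) auto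
  then show ?thesis
    by eventually_elim (metis enn_powr_eq_top[OF alpha_pos] less_top infinity_ennreal_def)
qed

lemma nn_integral_abs_increment_finite: "(\<integral>\<^sup>+y. ennreal \<bar>increment (polar y)\<bar> \<partial>L) < \<infinity>"
proof (cases "\<alpha> \<le> 1")
  case True
  have "(\<integral>\<^sup>+y. ennreal \<bar>increment (polar y)\<bar> \<partial>L) \<le> (\<integral>\<^sup>+y. ennreal (C powr \<alpha>) \<partial>L)"
    using AE_polar_anchor
  proof (intro nn_integral_mono_AE, eventually_elim)
    case (elim y)
    then show ?case using F.tail_power_step_le[OF True, of "polar y"] by (simp add: ennreal_leI)
  qed
  also have "\<dots> < \<infinity>" by (simp add: ennreal_mult_less_top emeasure_eq_measure)
  finally show ?thesis .
next
  case False
  have [measurable]: "sum_norm N J \<in> borel_measurable borel" for J by (rule sum_norm_measurable[OF norm])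
  have "(\<integral>\<^sup>+y. ennreal \<bar>increment (polar y)\<bar> \<partial>L) = ennreal extremal_index *
      (\<integral>\<^sup>+q. (\<integral>\<^sup>+j. ennreal \<bar>F.tail_power j q - F.tail_power (j + 1) q\<bar> \<partial>count_space UNIV) \<partial>cluster_law)"
    by (rule nn_integral_increment[symmetric]) (auto simp: abs_mult)
  also have "\<dots> \<le> ennreal extremal_index *
      (\<integral>\<^sup>+q. ennreal (\<alpha> * C powr \<alpha>) * enn_powr (sum_norm N UNIV q) \<alpha> \<partial>cluster_law)"
    using False by (intro mult_left_mono nn_integral_mono F.sum_tail_power_steps_le) auto
  also have "\<dots> = ennreal extremal_index *
      (ennreal (\<alpha> * C powr \<alpha>) * (\<integral>\<^sup>+q. enn_powr (sum_norm N UNIV q) \<alpha> \<partial>cluster_law))"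
    by (subst nn_integral_cmult) auto
  also have "\<dots> < \<infinity>" using moment by (simp add: ennreal_mult_less_top)
  finally show ?thesis .
qed

lemma nn_integral_H_power_finite: "(\<integral>\<^sup>+q. ennreal (H q powr \<alpha>) \<partial>cluster_law) < \<infinity>"
proof -
  have [measurable]: "sum_norm N J \<in> borel_measurable borel" for J by (rule sum_norm_measurable[OF norm])
  have "(\<integral>\<^sup>+q. ennreal (H q powr \<alpha>) \<partial>cluster_law)
      \<le> (\<integral>\<^sup>+q. ennreal (C powr \<alpha>) * enn_powr (sum_norm N UNIV q) \<alpha> \<partial>cluster_law)"
    by (intro nn_integral_mono F.H_power_le)
  also have "\<dots> = ennreal (C powr \<alpha>) * (\<integral>\<^sup>+q. enn_powr (sum_norm N UNIV q) \<alpha> \<partial>cluster_law)"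
    by (rule nn_integral_cmult) measurable
  also have "\<dots> < \<infinity>" using moment by (simp add: ennreal_mult_less_top)
  finally show ?thesis .
qed

text \<open>Integrate \<open>tail_power_telescope\<close> and turn the two sums into the positive and the negative
  part of the increment at $0$; both are finite, so they can be subtracted.\<close>

theorem cluster_index_formula:
  "integrable L (\<lambda>y. increment (polar y))"
  "integrable cluster_law (\<lambda>q. H q powr \<alpha>)"
  "extremal_index * (\<integral>q. H q powr \<alpha> \<partial>cluster_law) = (\<integral>y. increment (polar y) \<partial>L)"
proof -
  show int1: "integrable L (\<lambda>y. increment (polar y))"
    using nn_integral_abs_increment_finite by (intro integrableI_bounded) auto
  show "integrable cluster_law (\<lambda>q. H q powr \<alpha>)"
    using nn_integral_H_power_finite by (intro integrableI_bounded) auto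
  define I where "I = (\<integral>\<^sup>+q. ennreal (H q powr \<alpha>) \<partial>cluster_law)"
  define p where "p = (\<integral>\<^sup>+y. ennreal (increment (polar y)) \<partial>L)"
  define m where "m = (\<integral>\<^sup>+y. ennreal (- increment (polar y)) \<partial>L)"
  let ?m = "\<lambda>q. \<integral>\<^sup>+j. ennreal (F.tail_power (j + 1) q - F.tail_power j q) \<partial>count_space UNIV"
  have [measurable]: "?m \<in> borel_measurable borel"
    by (rule borel_measurable_nn_integral_countable) measurable
  have pos_part: "ennreal extremal_index * (\<integral>\<^sup>+q. (\<integral>\<^sup>+j. ennreal (F.tail_power j q - F.tail_power (j + 1) q)
      \<partial>count_space UNIV) \<partial>cluster_law) = p"
    unfolding p_def using nn_integral_increment[of "\<lambda>r. r"] by simp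
  have neg_part: "ennreal extremal_index * (\<integral>\<^sup>+q. ?m q \<partial>cluster_law) = m"
    unfolding m_def using nn_integral_increment[of "\<lambda>r. - r"] by simp
  have "(\<integral>\<^sup>+q. (\<integral>\<^sup>+j. ennreal (F.tail_power j q - F.tail_power (j + 1) q) \<partial>count_space UNIV) \<partial>cluster_law)
      = (\<integral>\<^sup>+q. ennreal (H q powr \<alpha>) + ?m q \<partial>cluster_law)"
    using AE_sum_norm_finite
    by (intro nn_integral_cong_AE, eventually_elim) (rule F.tail_power_telescope)
  also have "\<dots> = I + (\<integral>\<^sup>+q. ?m q \<partial>cluster_law)"
    unfolding I_def by (rule nn_integral_add) measurable
  finally have eq: "p = ennreal extremal_index * I + m"
    unfolding pos_part[symmetric] neg_part[symmetric] by (simp add: distrib_left)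
  have "p \<le> (\<integral>\<^sup>+y. ennreal \<bar>increment (polar y)\<bar> \<partial>L)" "m \<le> (\<integral>\<^sup>+y. ennreal \<bar>increment (polar y)\<bar> \<partial>L)"
    unfolding p_def m_def by (auto intro!: nn_integral_mono ennreal_leI)
  then have fin: "m < \<infinity>" using nn_integral_abs_increment_finite by (auto intro: order.strict_trans1)
  have I: "I < \<infinity>" unfolding I_def by (rule nn_integral_H_power_finite)
  have "(\<integral>y. increment (polar y) \<partial>L) = enn2real p - enn2real m"
    unfolding p_def m_def by (rule real_lebesgue_integral_def[OF int1])
  also have "enn2real p = extremal_index * enn2real I + enn2real m"
    unfolding eq using fin I extremal_index_pos
    by (subst enn2real_plus) (auto simp: enn2real_mult ennreal_mult_less_top)
  also have "enn2real I = (\<integral>q. H q powr \<alpha> \<partial>cluster_law)"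
    unfolding I_def by (subst integral_eq_nn_integral) auto
  finally show "extremal_index * (\<integral>q. H q powr \<alpha> \<partial>cluster_law) = (\<integral>y. increment (polar y) \<partial>L)" by simp
qed

end

theorem corollary3p12:
  fixes N :: "real ^ 'n \<Rightarrow> real"
    and M :: "'w measure" and X :: "int \<Rightarrow> 'w \<Rightarrow> real ^ 'n"
    and \<nu> :: "int \<Rightarrow> int \<Rightarrow> (int \<Rightarrow> real ^ 'n) measure" and \<alpha> :: real
    and P :: "'v measure" and Y :: "int \<Rightarrow> 'v \<Rightarrow> real ^ 'n"
    and \<Theta> :: "int \<Rightarrow> 'v \<Rightarrow> real ^ 'n"
    and R :: "'q measure" and Q :: "int \<Rightarrow> 'q \<Rightarrow> real ^ 'n"
    and H :: "(int \<Rightarrow> real ^ 'n) \<Rightarrow> real" and C :: real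
    and \<theta> :: real
  assumes "is_norm N"
    and "prob_space M" and "stationary_series M X"
    and "regularly_varying N M X \<nu>" and "\<alpha> > 0" and "tail_index \<nu> \<alpha>"
    and "prob_space P" and "tail_process N \<alpha> M X P Y"
    and "\<Theta> = spectral_tail N Y"
    and "\<theta> = candidate_extremal_index N P Y"
    and "prob_space R" and "cluster_process N P Y R Q"
    and "AE \<omega> in P. ((\<lambda>t. N (Y t \<omega>)) \<longlongrightarrow> 0) (filtercomap (\<lambda>t::int. \<bar>t\<bar>) at_top)"
    and "(\<integral>\<^sup>+\<omega>. enn_powr (sum_norm N UNIV (\<lambda>j. Q j \<omega>)) \<alpha> \<partial>R) < \<infinity> \<or>
         (\<integral>\<^sup>+\<omega>. enn_powr (sum_norm N {0..} (\<lambda>j. \<Theta> j \<omega>)) (\<alpha> - 1) \<partial>P) < \<infinity>"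
    and "H \<in> borel_measurable borel" and "\<And>x. H x \<ge> 0"
    and "shift_invariant H" and "one_homogeneous H"
    and "C > 0"
    and "\<And>x y. ennreal \<bar>H x - H y\<bar> \<le> ennreal C * sum_norm N UNIV (\<lambda>j. x j - y j)"
  shows "integrable P (\<lambda>\<omega>. H (zero_before 0 (\<lambda>j. \<Theta> j \<omega>)) powr \<alpha> -
                           H (zero_before 1 (\<lambda>j. \<Theta> j \<omega>)) powr \<alpha>) \<and>
         integrable R (\<lambda>\<omega>. H (\<lambda>j. Q j \<omega>) powr \<alpha>) \<and>
         \<theta> * (\<integral>\<omega>. H (\<lambda>j. Q j \<omega>) powr \<alpha> \<partial>R) =
           (\<integral>\<omega>. H (zero_before 0 (\<lambda>j. \<Theta> j \<omega>)) powr \<alpha> -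
                 H (zero_before 1 (\<lambda>j. \<Theta> j \<omega>)) powr \<alpha> \<partial>P)"
proof -
  interpret T: tail_process_setting N \<alpha> M X P Y
    by (rule tail_process_setting.intro) (rule assms)+
  interpret R: prob_space R by (rule assms)
  have law: "tail_law T.law N \<alpha>"
    by (rule T.tail_law_law) (rule assms)
  interpret L: tail_law T.law N \<alpha> by (rule law)
  have Q_measurable [measurable]: "(\<lambda>\<omega> j. Q j \<omega>) \<in> borel_measurable R"
    using assms(12) by (intro measurable_coordinatewise_then_product) (simp add: cluster_process_def)
  have [measurable]: "sum_norm N J \<in> borel_measurable borel" for J by (rule sum_norm_measurable[OF L.norm])
  have [measurable]: "sup_norm N J \<in> borel_measurable borel" for J
    by (rule sup_norm_measurable[OF L.norm])
  have theta: "\<theta> = L.extremal_index"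
  proof -
    have "\<theta> = measure T.law {y. sup_norm N {1..} y \<le> 1}"
      unfolding \<open>\<theta> = _\<close> candidate_extremal_index_def
      by (subst measure_distr) (auto simp: vimage_def Int_def conj_commute)
    then show ?thesis unfolding L.extremal_index_def L.extremal_index_symmetric .
  qed
  \<comment> \<open>The law of $Q$ is a function of the law of $Y$: condition on the past and divide by the peak.\<close>
  have Q_law: "distr R borel (\<lambda>\<omega> j. Q j \<omega>) = L.cluster_law"
  proof -
    let ?A = "{y. sup_norm N {..-1} y \<le> 1}"
    let ?B = "{\<omega> \<in> space P. sup_norm N {..-1} (\<lambda>j. Y j \<omega>) \<le> 1}"
    have [measurable]: "?B \<in> sets P" by measurable
    have mass: "emeasure T.law ?A = emeasure P ?B"
      by (subst emeasure_distr) (auto simp: vimage_def Int_def conj_commute)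
    have "uniform_measure T.law ?A
        = distr (density P (\<lambda>\<omega>. indicator ?A (\<lambda>j. Y j \<omega>) / emeasure T.law ?A)) borel (\<lambda>\<omega> j. Y j \<omega>)"
      unfolding uniform_measure_def by (rule density_distr) measurable
    also have "density P (\<lambda>\<omega>. indicator ?A (\<lambda>j. Y j \<omega>) / emeasure T.law ?A) = uniform_measure P ?B"
      unfolding uniform_measure_def mass
    proof (rule density_cong)
      show "AE \<omega> in P. (indicator ?A (\<lambda>j. Y j \<omega>) :: ennreal) / emeasure P ?B = indicator ?B \<omega> / emeasure P ?B"
        by (rule AE_I2) (simp add: indicator_def)
    qed measurable
    finally have "uniform_measure T.law ?A = distr (uniform_measure P ?B) borel (\<lambda>\<omega> j. Y j \<omega>)" .
    then have "L.cluster_law = distr (uniform_measure P ?B) borel (L.normalize_peak \<circ> (\<lambda>\<omega> j. Y j \<omega>))"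
      unfolding L.cluster_law_def by (simp add: distr_distr)
    also have "L.normalize_peak \<circ> (\<lambda>\<omega> j. Y j \<omega>) =
        (\<lambda>\<omega> j. inverse (enn2real (sup_norm N UNIV (\<lambda>i. Y i \<omega>))) *\<^sub>R Y j \<omega>)"
      by (simp add: L.normalize_peak_def L.peak_def fun_eq_iff)
    finally show ?thesis using assms(12) by (simp add: cluster_process_def)
  qed
  \<comment> \<open>Conditioning on a null event would give the zero measure, which is not the law of $Q$.\<close>
  have pos: "L.extremal_index > 0"
  proof (rule ccontr)
    let ?A = "{y. sup_norm N {..-1} y \<le> 1}"
    assume "\<not> L.extremal_index > 0"
    then have "emeasure T.law ?A = 0"
      by (simp add: L.extremal_index_def L.emeasure_eq_measure measure_nonneg antisym_conv3)
    then have "emeasure L.cluster_law UNIV = 0"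
      unfolding L.cluster_law_def
      by (subst emeasure_distr) (auto simp: emeasure_uniform_measure)
    moreover have "emeasure (distr R borel (\<lambda>\<omega> j. Q j \<omega>)) UNIV = 1"
      by (subst emeasure_distr) (auto simp: R.emeasure_space_1)
    ultimately show False unfolding Q_law by simp
  qed
  have polar: "(\<lambda>j. \<Theta> j \<omega>) = L.polar (\<lambda>j. Y j \<omega>)" for \<omega>
    unfolding \<open>\<Theta> = _\<close> spectral_tail_def L.polar_def by simp
  have "(\<integral>\<^sup>+q. enn_powr (sum_norm N UNIV q) \<alpha> \<partial>L.cluster_law) < \<infinity> \<or>
      (\<integral>\<^sup>+y. enn_powr (sum_norm N {0..} (L.polar y)) (\<alpha> - 1) \<partial>T.law) < \<infinity>"
    using assms(14) unfolding Q_law[symmetric] polar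
    by (simp add: nn_integral_distr)
  then have "(\<integral>\<^sup>+q. enn_powr (sum_norm N UNIV q) \<alpha> \<partial>L.cluster_law) < \<infinity>"
    by (rule L.cluster_sum_moment[OF pos])
  with law pos interpret F: cluster_functional T.law N H C \<alpha>
    by (intro cluster_functional.intro lipschitz_functional.intro cluster_functional_axioms.intro)
      (assumption | rule assms)+
  have inc: "F.increment (L.polar (\<lambda>j. Y j \<omega>)) = H (zero_before 0 (\<lambda>j. \<Theta> j \<omega>)) powr \<alpha> -
      H (zero_before 1 (\<lambda>j. \<Theta> j \<omega>)) powr \<alpha>" for \<omega>
    unfolding F.F.tail_power_def polar ..
  have "integrable P (\<lambda>\<omega>. F.increment (L.polar (\<lambda>j. Y j \<omega>)))"
    using F.cluster_index_formula(1) by (subst (asm) integrable_distr_eq) auto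
  moreover have "integrable R (\<lambda>\<omega>. H (\<lambda>j. Q j \<omega>) powr \<alpha>)"
    using F.cluster_index_formula(2) unfolding Q_law[symmetric]
    by (subst (asm) integrable_distr_eq) auto
  moreover have "(\<integral>y. F.increment (L.polar y) \<partial>T.law) = (\<integral>\<omega>. F.increment (L.polar (\<lambda>j. Y j \<omega>)) \<partial>P)"
    by (rule integral_distr) measurable
  moreover have "(\<integral>q. H q powr \<alpha> \<partial>L.cluster_law) = (\<integral>\<omega>. H (\<lambda>j. Q j \<omega>) powr \<alpha> \<partial>R)"
    unfolding Q_law[symmetric] by (rule integral_distr) measurable
  ultimately show ?thesis
    using F.cluster_index_formula(3) unfolding inc theta by simp
qed

end
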